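(* Let $n\ge 1$ be an integer and let $G_n$ be the group $$G_n=\langle \sigma,\tau,\rho:\ \rho^4=\sigma^8=\tau^{2^{n+2}}=1,\ \sigma^4=\tau^{2^{n+1}},\ \rho^2=\tau^{2^n}\sigma^2,\ [\tau,\sigma]=1,\ [\rho,\sigma]=\sigma^{-2},\ [\rho,\tau]=\tau^2\rangle .$$ Then $G_n$ admits seven subgroups of index $4$, and these are the following subgroups $H_{1,4},\dots,H_{7,4}$, whose derived subgroups and abelianizations are as indicated: 1. $H_{1,4}=\langle\sigma,\tau^2\rangle$, $H_{1,4}'=\langle1\rangle$, $H_{1,4}/H_{1,4}'$ is of type $(2^{\min(n,2)},2^{\max(n+1,3)})$. 2. $H_{2,4}=\langle\tau,\sigma^2\rangle$, $H_{2,4}'=\langle1\rangle$, $H_{2,4}/H_{2,4}'$ is of type $(2,2^{n+2})$. 3. $H_{3,4}=\langle\rho,\tau^2\rangle$, $H_{3,4}'=\langle\tau^4\rangle$, $H_{3,4}/H_{3,4}'$ is of type $(2,4)$. 4. $H_{4,4}=\langle\sigma\tau,\sigma^2\rangle$, $H_{4,4}'=\langle1\rangle$, $H_{4,4}/H_{4,4}'$ is of type $(4,4)$ if $n=1$ and of type $(2,2^{n+2})$ if $n\ge2$. 5. $H_{5,4}=\langle\sigma\rho,\tau^2\rangle$, $H_{5,4}'=\langle\tau^4\rangle$, $H_{5,4}/H_{5,4}'$ is of type $(2,4)$. 6. $H_{6,4}=\langle\tau\rho,\tau^2\rangle$, $H_{6,4}'=\langle\tau^4\rangle$, $H_{6,4}/H_{6,4}'$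 is of type $(2,4)$. 7. $H_{7,4}=\langle\sigma\tau\rho,\tau^2\rangle$, $H_{7,4}'=\langle\tau^4\rangle$, $H_{7,4}/H_{7,4}'$ is of type $(2,4)$.
   Context: Commutators are $[x,y]=x^{-1}y^{-1}xy$, and $H'=[H,H]$ is the derived subgroup of $H$. A finite abelian group is of type $(a_1,\dots,a_r)$ if it is isomorphic to $\mathbb{Z}/a_1\mathbb{Z}\times\cdots\times\mathbb{Z}/a_r\mathbb{Z}$.
   Formalization: The seven subgroups are shown to be exactly the normal subgroups of index 4; without "normal" the list is incomplete for every n: ⟨σ,ρ,τ⁴⟩ (n≥2) and ⟨ρ,στ⟩ (n=1) are further, non-normal subgroups of index 4. *)

theory Defs
  imports "HOL-Algebra.Algebra"
begin

section \<open>Words and group presentations\<close>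

text \<open>The letter \<open>(x, True)\<close> stands for the generator \<open>x\<close>, and \<open>(x, False)\<close> for its inverse.\<close>

type_synonym 'a gword = "('a \<times> bool) list"

definition word_gen :: "'a \<Rightarrow> 'a gword" where
  "word_gen x = [(x, True)]"

definition word_inv :: "'a gword \<Rightarrow> 'a gword" where
  "word_inv w = rev (map (\<lambda>(x, b). (x, \<not> b)) w)"

definition word_pow :: "'a gword \<Rightarrow> nat \<Rightarrow> 'a gword" where
  "word_pow w k = concat (replicate k w)"

definition word_comm :: "'a gword \<Rightarrow> 'a gword \<Rightarrow> 'a gword" where
  "word_comm u v = word_inv u @ word_inv v @ u @ v"

text \<open>
  A pair \<open>(u, v)\<close> in \<open>R\<close> is a defining relation \<open>u = v\<close>. Two words are equivalent if one can be
  turned into the other by free insertions and cancellations and by replacing a factor by the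
  other side of a defining relation, i.e. if they represent the same element of
  \<open>\<langle>'a : u = v for (u, v) \<in> R\<rangle>\<close>.
\<close>

inductive word_equiv :: "('a gword \<times> 'a gword) set \<Rightarrow> 'a gword \<Rightarrow> 'a gword \<Rightarrow> bool"
  for R where
  refl: "word_equiv R w w"
| sym: "word_equiv R u v \<Longrightarrow> word_equiv R v u"
| trans: "word_equiv R u v \<Longrightarrow> word_equiv R v w \<Longrightarrow> word_equiv R u w"
| cancel: "word_equiv R (u @ [(x, b), (x, \<not> b)] @ v) (u @ v)"
| relation: "(r, s) \<in> R \<Longrightarrow> word_equiv R (u @ r @ v) (u @ s @ v)"

definition word_class :: "('a gword \<times> 'a gword) set \<Rightarrow> 'a gword \<Rightarrow> 'a gword set" where
  "word_class R w = {v. word_equiv R w v}"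

definition presented_group :: "('a gword \<times> 'a gword) set \<Rightarrow> 'a gword set monoid" where
  "presented_group R =
     \<lparr>carrier = range (word_class R),
      monoid.mult = (\<lambda>A B. \<Union>u\<in>A. \<Union>v\<in>B. word_class R (u @ v)),
      one = word_class R []\<rparr>"

lemma word_equiv_append_left: "word_equiv R u v \<Longrightarrow> word_equiv R (w @ u) (w @ v)"
proof (induction rule: word_equiv.induct)
  case (cancel u x b v)
  then show ?case using word_equiv.cancel[of R "w @ u" x b v] by simp
next
  case (relation r s u v)
  then show ?case using word_equiv.relation[of r s R "w @ u" v] by simp
next
  case (refl u)
  show ?case by (rule word_equiv.refl)
next
  case (sym u v)
  from sym.IH show ?case by (rule word_equiv.sym)
next
  case (trans u v v')
  from trans.IH show ?case by (rule word_equiv.trans)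
qed

lemma word_equiv_append_right: "word_equiv R u v \<Longrightarrow> word_equiv R (u @ w) (v @ w)"
proof (induction rule: word_equiv.induct)
  case (cancel u x b v)
  then show ?case using word_equiv.cancel[of R u x b "v @ w"] by simp
next
  case (relation r s u v)
  then show ?case using word_equiv.relation[of r s R u "v @ w"] by simp
next
  case (refl u)
  show ?case by (rule word_equiv.refl)
next
  case (sym u v)
  from sym.IH show ?case by (rule word_equiv.sym)
next
  case (trans u v v')
  from trans.IH show ?case by (rule word_equiv.trans)
qed

lemma word_equiv_append:
  "word_equiv R u u' \<Longrightarrow> word_equiv R v v' \<Longrightarrow> word_equiv R (u @ v) (u' @ v')"
  by (rule word_equiv.trans[OF word_equiv_append_right word_equiv_append_left])

lemma word_class_eq_iff: "word_class R u = word_class R v \<longleftrightarrow> word_equiv R u v"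
proof
  assume "word_class R u = word_class R v"
  moreover have "v \<in> word_class R v" by (simp add: word_class_def word_equiv.refl)
  ultimately have "v \<in> word_class R u" by simp
  then show "word_equiv R u v" by (simp add: word_class_def)
next
  assume "word_equiv R u v"
  then have "word_equiv R u w \<longleftrightarrow> word_equiv R v w" for w
    by (meson word_equiv.sym word_equiv.trans)
  then show "word_class R u = word_class R v" by (simp add: word_class_def)
qed

lemma word_equiv_inv_left: "word_equiv R (word_inv w @ w) []"
proof (induction w)
  case Nil
  then show ?case by (simp add: word_inv_def word_equiv.refl)
next
  case (Cons a w)
  obtain x b where a: "a = (x, b)" by (cases a)
  have "word_equiv R (word_inv w @ [(x, \<not> b), (x, \<not> \<not> b)] @ w) []"
    using word_equiv.cancel Cons.IH by (rule word_equiv.trans)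
  then show ?case by (simp add: word_inv_def a)
qed

lemma mult_presented_group [simp]:
  "word_class R u \<otimes>\<^bsub>presented_group R\<^esub> word_class R v = word_class R (u @ v)"
proof -
  have const: "word_class R (u' @ v') = word_class R (u @ v)"
    if "u' \<in> word_class R u" "v' \<in> word_class R v" for u' v'
  proof -
    have "word_equiv R (u @ v) (u' @ v')"
      using that by (intro word_equiv_append) (simp_all add: word_class_def)
    then show ?thesis by (metis word_class_eq_iff)
  qed
  have mem: "w \<in> word_class R w" for w
    by (simp add: word_class_def word_equiv.refl)
  have "(\<Union>u'\<in>word_class R u. \<Union>v'\<in>word_class R v. word_class R (u' @ v')) =
      (\<Union>u'\<in>word_class R u. \<Union>v'\<in>word_class R v. word_class R (u @ v))"
    using const by (intro SUP_cong HOL.refl)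
  also have "\<dots> = word_class R (u @ v)"
    using mem[of u] mem[of v] by blast
  finally show ?thesis by (simp add: presented_group_def)
qed

lemma group_presented_group: "group (presented_group R)"
proof (rule groupI)
  show "\<exists>y\<in>carrier (presented_group R). y \<otimes>\<^bsub>presented_group R\<^esub> x = \<one>\<^bsub>presented_group R\<^esub>"
    if x: "x \<in> carrier (presented_group R)" for x
  proof -
    obtain w where w: "x = word_class R w" using x by (auto simp: presented_group_def)
    have "word_class R (word_inv w) \<otimes>\<^bsub>presented_group R\<^esub> x = \<one>\<^bsub>presented_group R\<^esub>"
      unfolding w mult_presented_group
      by (simp add: presented_group_def word_class_eq_iff word_equiv_inv_left)
    then show ?thesis by (auto simp: presented_group_def)
  qed
next
  fix x y z
  assume "x \<in> carrier (presented_group R)" "y \<in> carrier (presented_group R)"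
    "z \<in> carrier (presented_group R)"
  then obtain u v w where "x = word_class R u" "y = word_class R v" "z = word_class R w"
    by (auto simp: presented_group_def)
  then show "x \<otimes>\<^bsub>presented_group R\<^esub> y \<otimes>\<^bsub>presented_group R\<^esub> z =
      x \<otimes>\<^bsub>presented_group R\<^esub> (y \<otimes>\<^bsub>presented_group R\<^esub> z)"
    by simp
next
  fix x y
  assume "x \<in> carrier (presented_group R)" "y \<in> carrier (presented_group R)"
  then obtain u v where "x = word_class R u" "y = word_class R v"
    by (auto simp: presented_group_def)
  then show "x \<otimes>\<^bsub>presented_group R\<^esub> y \<in> carrier (presented_group R)"
    by simp (simp add: presented_group_def)
next
  show "\<one>\<^bsub>presented_group R\<^esub> \<in> carrier (presented_group R)"
    by (simp add: presented_group_def)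
next
  fix x assume "x \<in> carrier (presented_group R)"
  then obtain u where u: "x = word_class R u" by (auto simp: presented_group_def)
  have "\<one>\<^bsub>presented_group R\<^esub> = word_class R []" by (simp add: presented_group_def)
  then show "\<one>\<^bsub>presented_group R\<^esub> \<otimes>\<^bsub>presented_group R\<^esub> x = x" by (simp add: u)
qed

section \<open>The groups \<open>G_n\<close>\<close>

datatype gen = Sigma_gen | Tau_gen | Rho_gen

definition G_relations :: "nat \<Rightarrow> (gen gword \<times> gen gword) set" where
  "G_relations n =
    (let s = word_gen Sigma_gen; t = word_gen Tau_gen; r = word_gen Rho_gen in
     {(word_pow r 4, []),
      (word_pow s 8, []),
      (word_pow t (2 ^ (n + 2)), []),
      (word_pow s 4, word_pow t (2 ^ (n + 1))),
      (word_pow r 2, word_pow t (2 ^ n) @ word_pow s 2),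
      (word_comm t s, []),
      (word_comm r s, word_pow (word_inv s) 2),
      (word_comm r t, word_pow t 2)})"

definition G_grp :: "nat \<Rightarrow> gen gword set monoid" where
  "G_grp n = presented_group (G_relations n)"

definition G_gen :: "nat \<Rightarrow> gen \<Rightarrow> gen gword set" where
  "G_gen n x = word_class (G_relations n) (word_gen x)"

section \<open>Abelianizations and types of finite abelian groups\<close>

text \<open>
  The library's \<^const>\<open>derived\<close> is generated by the commutators \<open>x y x\<^sup>-\<^sup>1 y\<^sup>-\<^sup>1\<close> rather than
  \<open>x\<^sup>-\<^sup>1 y\<^sup>-\<^sup>1 x y\<close>; on a subgroup both families consist of the same elements.
\<close>

definition abelianization :: "('a, 'b) monoid_scheme \<Rightarrow> 'a set \<Rightarrow> 'a set monoid" where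
  "abelianization G H = (G\<lparr>carrier := H\<rparr>) Mod (derived G H)"

definition of_abelian_type :: "('a, 'b) monoid_scheme \<Rightarrow> nat list \<Rightarrow> bool" where
  "of_abelian_type A as \<longleftrightarrow>
     comm_group A \<and> finite (carrier A) \<and>
     A \<cong> product_group {..<length as} (\<lambda>i. integer_mod_group (as ! i))"

end

theory Submission
  imports Defs
begin

text \<open>
  Put \<open>N = 2 ^ (n - 1)\<close>. The subgroup \<open>\<langle>\<sigma>, \<tau>\<rangle>\<close> is abelian and normal of index \<open>2\<close>: the
  relations say that conjugation by \<open>\<rho>\<close> maps \<open>\<sigma>\<close> to \<open>\<sigma>\<^sup>3\<close> and \<open>\<tau>\<close> to its inverse. So every element is
  \<open>\<rho>\<^sup>c \<sigma>\<^sup>a \<tau>\<^sup>b\<close> for some integers \<open>c\<close>, \<open>a\<close>, \<open>b\<close>, and the product of two such elements has an explicit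
  normal form (\<open>nf_mult\<close>). The only ambiguity of the exponents comes from \<open>\<rho>\<^sup>2 = \<tau>\<^sup>2\<^sup>N \<sigma>\<^sup>2\<close>,
  \<open>\<sigma>\<^sup>4 = \<tau>\<^sup>4\<^sup>N\<close> and \<open>\<tau>\<^sup>8\<^sup>N = 1\<close>, and these three relations together preserve exactly \<open>c mod 2\<close>,
  \<open>c + a mod 4\<close> and \<open>b - N a mod 8 N\<close> (\<open>same_exps\<close>). That no further collapse happens is seen by
  letting the free group act on triples of integers from the right, the way a letter acts on
  normal forms: both sides of each defining relation act in the same way up to \<open>same_exps\<close>, so
  equivalent words move \<open>(0, 0, 0)\<close> to equivalent triples (\<open>fold_act_word_equiv\<close>). From there on
  all questions about the group are congruences between exponents (\<open>nf_eq_iff\<close>).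

  The parities of \<open>(c, a, b)\<close> are well defined and give a surjection onto \<open>(\<int>/2)\<^sup>3\<close>, whose kernel
  consists of the products of powers of \<open>\<sigma>\<^sup>2\<close> and \<open>\<tau>\<^sup>2\<close>. A normal subgroup of index \<open>4\<close> has an abelian quotient,
  so it contains the commutators \<open>\<sigma>\<^sup>-\<^sup>2\<close> and \<open>\<tau>\<^sup>2\<close>, hence this kernel; comparing orders, it is the
  preimage of a group \<open>{0, v}\<close> with \<open>v \<noteq> 0\<close> (\<open>normal_index_4_eq\<close>). The seven choices of \<open>v\<close> are the
  seven subgroups.

  If \<open>v\<close> has an even \<open>\<rho>\<close>-component, the subgroup lies in the abelian group \<open>\<langle>\<sigma>, \<tau>\<rangle>\<close>. If that
  component is odd, the multiplication formula shows that any two elements commute up to a power of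
  \<open>\<tau>\<^sup>4\<close>, which is itself a commutator with \<open>\<tau>\<^sup>2\<close>; this treats four subgroups at once. Finally, an
  abelianization is \<open>\<int>/m \<times> \<int>/k\<close> as soon as it is generated by two elements whose only relations
  are the multiples of \<open>m\<close> and of \<open>k\<close> (\<open>abelianization_of_type_two\<close>), and in every case such a pair can
  be written down.
\<close>

section \<open>Abelian groups on two generators, and groups of order four\<close>

text \<open>If \<open>x\<close> and \<open>y\<close> do not commute, then \<open>1\<close>, \<open>x\<close>, \<open>y\<close>, \<open>x y\<close> and \<open>y x\<close> are five different elements.\<close>
lemma comm_group_if_order_4:
  assumes "group Q" and "card (carrier Q) = 4"
  shows "comm_group Q"
proof (rule group.group_comm_groupI[OF assms(1)])
  interpret group Q by fact
  fix x y assume x: "x \<in> carrier Q" and y: "y \<in> carrier Q"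
  show "x \<otimes>\<^bsub>Q\<^esub> y = y \<otimes>\<^bsub>Q\<^esub> x"
  proof (rule ccontr)
    assume neq: "x \<otimes>\<^bsub>Q\<^esub> y \<noteq> y \<otimes>\<^bsub>Q\<^esub> x"
    let ?E = "{\<one>\<^bsub>Q\<^esub>, x, y, x \<otimes>\<^bsub>Q\<^esub> y, y \<otimes>\<^bsub>Q\<^esub> x}"
    have "x \<noteq> \<one>\<^bsub>Q\<^esub>" "y \<noteq> \<one>\<^bsub>Q\<^esub>" "x \<noteq> y"
      using neq x y by auto
    moreover have "x \<otimes>\<^bsub>Q\<^esub> y \<noteq> \<one>\<^bsub>Q\<^esub>" "y \<otimes>\<^bsub>Q\<^esub> x \<noteq> \<one>\<^bsub>Q\<^esub>"
      using neq x y inv_comm by metis+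
    moreover have "x \<otimes>\<^bsub>Q\<^esub> y \<noteq> x" "x \<otimes>\<^bsub>Q\<^esub> y \<noteq> y" "y \<otimes>\<^bsub>Q\<^esub> x \<noteq> x" "y \<otimes>\<^bsub>Q\<^esub> x \<noteq> y"
      using x y calculation(1,2) by (simp_all add: l_cancel_one r_cancel_one)
    ultimately have "card ?E = 5"
      using neq by auto
    moreover have "card ?E \<le> card (carrier Q)"
      using x y assms(2) by (intro card_mono) (auto intro: card_ge_0_finite)
    ultimately show False
      using assms(2) by simp
  qed
qed

lemma (in group) commute_up_to_normal:
  assumes "H \<lhd> G" and "card (rcosets H) = 4"
    and x: "x \<in> carrier G" and y: "y \<in> carrier G" and z: "z \<in> carrier G"
    and eq: "x \<otimes> y = z \<otimes> (y \<otimes> x)"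
  shows "z \<in> H"
proof -
  interpret normal H G by fact
  have "comm_group (G Mod H)"
    using assms(2) by (intro comm_group_if_order_4 factorgroup_is_group) (simp add: FactGroup_def)
  then interpret Q: comm_group "G Mod H" .
  have cl: "H #> x \<in> carrier (G Mod H)" "H #> y \<in> carrier (G Mod H)" "H #> z \<in> carrier (G Mod H)"
    using x y z by (auto simp: FactGroup_def rcosetsI[OF subset])
  have "H #> (x \<otimes> y) = H #> (y \<otimes> x)"
    using Q.m_comm[OF cl(1,2)] x y by (simp add: rcos_sum)
  then have "x \<otimes> y \<in> H #> (y \<otimes> x)"
    using rcos_self[of "x \<otimes> y" H] subgroup_axioms x y by simp
  then have "x \<otimes> y \<otimes> inv (y \<otimes> x) \<in> H"
    using x y by (intro rcos_module_imp) (simp_all add: is_group)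
  then show ?thesis
    using x y z by (simp add: eq inv_solve_right' m_assoc)
qed

text \<open>Two generators \<open>x\<close>, \<open>y\<close> whose relations are independent define an isomorphism
  \<open>\<int>/m \<times> \<int>/k \<rightarrow> A\<close>, \<open>(i, j) \<mapsto> x\<^sup>i y\<^sup>j\<close>.\<close>
lemma of_abelian_type_two:
  assumes A: "comm_group A" and x: "x \<in> carrier A" and y: "y \<in> carrier A"
    and m: "m > 0" and k: "k > 0"
    and gen: "\<And>z. z \<in> carrier A \<Longrightarrow> \<exists>(i::int) (j::int). z = x [^]\<^bsub>A\<^esub> i \<otimes>\<^bsub>A\<^esub> y [^]\<^bsub>A\<^esub> j"
    and rel: "\<And>(i::int) (j::int). x [^]\<^bsub>A\<^esub> i \<otimes>\<^bsub>A\<^esub> y [^]\<^bsub>A\<^esub> j = \<one>\<^bsub>A\<^esub> \<longleftrightarrow> int m dvd i \<and> int k dvd j"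
  shows "of_abelian_type A [m, k]"
proof -
  interpret comm_group A by fact
  let ?P = "product_group {..<length [m, k]} (\<lambda>i. integer_mod_group ([m, k] ! i))"
  define e where "e i j = x [^]\<^bsub>A\<^esub> i \<otimes>\<^bsub>A\<^esub> y [^]\<^bsub>A\<^esub> j" for i j :: int
  have ecl: "e i j \<in> carrier A" for i j
    using x y by (simp add: e_def)
  have eadd: "e i j \<otimes>\<^bsub>A\<^esub> e i' j' = e (i + i') (j + j')" for i j i' j'
    using x y by (simp add: e_def int_pow_mult m_ac)
  have e_eq: "e i j = e i' j' \<longleftrightarrow> int m dvd i - i' \<and> int k dvd j - j'" for i j i' j'
  proof -
    have "e i j = e (i - i') (j - j') \<otimes>\<^bsub>A\<^esub> e i' j'"
      by (simp add: eadd)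
    then have "e i j = e i' j' \<longleftrightarrow> e (i - i') (j - j') = \<one>\<^bsub>A\<^esub>"
      using ecl by (simp add: r_cancel_one')
    then show ?thesis
      using rel by (simp add: e_def)
  qed
  have set2: "{..<length [m, k]} = {0, 1}"
    by auto
  have carP: "carrier ?P = (\<Pi>\<^sub>E i\<in>{0, 1}. {0..<int ([m, k] ! i)})"
    unfolding carrier_product_group set2 using m k
    by (intro PiE_cong) (auto simp: carrier_integer_mod_group)
  have car: "f \<in> carrier ?P \<longleftrightarrow> f \<in> extensional {0, 1} \<and> f 0 \<in> {0..<int m} \<and> f 1 \<in> {0..<int k}" for f
    unfolding carP PiE_iff by auto
  define \<phi> where "\<phi> f = e (f 0) (f 1)" for f :: "nat \<Rightarrow> int"
  have hom: "\<phi> \<in> hom ?P A"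
  proof (rule homI)
    fix f f' assume "f \<in> carrier ?P" "f' \<in> carrier ?P"
    show "\<phi> (f \<otimes>\<^bsub>?P\<^esub> f') = \<phi> f \<otimes>\<^bsub>A\<^esub> \<phi> f'"
      unfolding \<phi>_def eadd e_eq by (simp add: mod_eq_dvd_iff[symmetric])
  qed (simp add: \<phi>_def ecl)
  have bij: "bij_betw \<phi> (carrier ?P) (carrier A)"
    unfolding bij_betw_def
  proof
    show "inj_on \<phi> (carrier ?P)"
    proof (rule inj_onI)
      fix f f' assume f: "f \<in> carrier ?P" "f' \<in> carrier ?P" and "\<phi> f = \<phi> f'"
      then have "int m dvd f 0 - f' 0" "int k dvd f 1 - f' 1"
        by (simp_all add: \<phi>_def e_eq)
      then have "f 0 mod int m = f' 0 mod int m" "f 1 mod int k = f' 1 mod int k"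
        by (simp_all add: mod_eq_dvd_iff)
      then have "f 0 = f' 0" "f 1 = f' 1"
        using f unfolding car by auto
      then show "f = f'"
        using f unfolding car by (intro extensionalityI[of _ "{0, 1}"]) auto
    qed
    show "\<phi> ` carrier ?P = carrier A"
    proof
      show "carrier A \<subseteq> \<phi> ` carrier ?P"
      proof
        fix z assume "z \<in> carrier A"
        from gen[OF this] obtain i j where z: "z = e i j"
          unfolding e_def by blast
        define f where "f = (\<lambda>l\<in>{0, 1::nat}. if l = 0 then i mod int m else j mod int k)"
        have "f \<in> carrier ?P"
          unfolding car using m k by (simp add: f_def)
        moreover have "z = \<phi> f"
          by (simp add: z \<phi>_def f_def e_eq)
        ultimately show "z \<in> \<phi> ` carrier ?P" by blast
      qed
    next
      show "\<phi> ` carrier ?P \<subseteq> carrier A"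
        unfolding \<phi>_def using ecl by blast
    qed
  qed
  have fin: "finite (carrier ?P)"
    unfolding carP by (intro finite_PiE) simp_all
  have "\<phi> \<in> iso ?P A"
    using hom bij unfolding iso_def by blast
  then have "?P \<cong> A"
    by (rule is_isoI)
  then have "A \<cong> ?P"
    by (rule group.iso_sym[OF product_group[OF group_integer_mod_group]])
  moreover have "finite (carrier A)"
    using fin bij bij_betw_finite by blast
  ultimately show ?thesis
    using A unfolding of_abelian_type_def by blast
qed

text \<open>The previous criterion for the quotient by the derived subgroup, with both hypotheses pulled back
  to \<open>G\<close> along the projection, so that cosets need not be handled when it is applied.\<close>
lemma (in group) abelianization_of_type_two:
  assumes H: "subgroup H G" and x: "x \<in> H" and y: "y \<in> H" and m: "m > 0" and k: "k > 0"
    and gen: "\<And>z. z \<in> H \<Longrightarrow> \<exists>(i::int) (j::int). z = x [^] i \<otimes> y [^] j"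
    and rel: "\<And>(i::int) (j::int). x [^] i \<otimes> y [^] j \<in> derived G H \<longleftrightarrow> int m dvd i \<and> int k dvd j"
  shows "of_abelian_type (abelianization G H) [m, k]"
proof -
  let ?H = "G\<lparr>carrier := H\<rparr>" and ?D = "derived G H"
  interpret H: group ?H by (rule subgroup_imp_group[OF H])
  have D: "?D = derived ?H (carrier ?H)"
    using derived_consistent[OF order.refl H] by simp
  interpret normal ?D ?H
    unfolding D by (rule H.derived_is_normal[OF H.normal_invI[OF H.subgroup_self]])
      (intro H.m_closed H.inv_closed; assumption)
  let ?Q = "?H Mod ?D" and ?\<pi> = "\<lambda>a. ?D #>\<^bsub>?H\<^esub> a"
  have Q: "comm_group ?Q"
    unfolding D by (rule H.derived_quot_is_comm_group)
  interpret Q: comm_group ?Q by fact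
  interpret \<pi>: group_hom ?H ?Q ?\<pi>
    using r_coset_hom_Mod by (intro group_hom.intro group_hom_axioms.intro) unfold_locales
  have pow: "?\<pi> x [^]\<^bsub>?Q\<^esub> i \<otimes>\<^bsub>?Q\<^esub> ?\<pi> y [^]\<^bsub>?Q\<^esub> j = ?\<pi> (x [^] i \<otimes> y [^] j)" for i j :: int
  proof -
    have "?\<pi> x [^]\<^bsub>?Q\<^esub> i \<otimes>\<^bsub>?Q\<^esub> ?\<pi> y [^]\<^bsub>?Q\<^esub> j = ?\<pi> (x [^]\<^bsub>?H\<^esub> i \<otimes>\<^bsub>?H\<^esub> y [^]\<^bsub>?H\<^esub> j)"
      using x y H.int_pow_closed[of x i] H.int_pow_closed[of y j] \<pi>.hom_int_pow[of x i]
        \<pi>.hom_int_pow[of y j] \<pi>.hom_mult[of "x [^]\<^bsub>?H\<^esub> i" "y [^]\<^bsub>?H\<^esub> j"] by simp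
    then show ?thesis
      using x y by (simp add: int_pow_consistent[OF H])
  qed
  have in_H: "x [^] i \<otimes> y [^] j \<in> H" for i j :: int
    using H x y by (intro subgroup.m_closed subgroup_int_pow_closed)
  show ?thesis
    unfolding abelianization_def
  proof (rule of_abelian_type_two[OF Q _ _ m k])
    show "?\<pi> x \<in> carrier ?Q" "?\<pi> y \<in> carrier ?Q"
      using x y \<pi>.hom_closed by auto
    show "\<exists>(i::int) (j::int). z = ?\<pi> x [^]\<^bsub>?Q\<^esub> i \<otimes>\<^bsub>?Q\<^esub> ?\<pi> y [^]\<^bsub>?Q\<^esub> j" if z: "z \<in> carrier ?Q" for z
    proof -
      obtain h where h: "h \<in> H" "z = ?\<pi> h"
        using z by (auto simp: FactGroup_def RCOSETS_def)
      from gen[OF h(1)] show ?thesis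
        unfolding pow h(2) by auto
    qed
    show "?\<pi> x [^]\<^bsub>?Q\<^esub> i \<otimes>\<^bsub>?Q\<^esub> ?\<pi> y [^]\<^bsub>?Q\<^esub> j = \<one>\<^bsub>?Q\<^esub> \<longleftrightarrow> int m dvd i \<and> int k dvd j"
      for i j :: int
    proof -
      have "?\<pi> (x [^] i \<otimes> y [^] j) = ?D \<longleftrightarrow> x [^] i \<otimes> y [^] j \<in> ?D"
        using in_H[of i j] H.coset_join1[of ?D] H.coset_join2[OF _ subgroup_axioms] subgroup_axioms
        by auto
      then show ?thesis
        unfolding pow rel[symmetric] by (simp add: FactGroup_def)
    qed
  qed
qed

section \<open>Presented groups and the evaluation of words\<close>

lemma one_presented_group: "\<one>\<^bsub>presented_group R\<^esub> = word_class R []"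
  by (simp add: presented_group_def)

lemma word_class_closed [simp]: "word_class R w \<in> carrier (presented_group R)"
  by (simp add: presented_group_def)

lemma word_class_pow:
  "word_class R (word_pow w k) = word_class R w [^]\<^bsub>presented_group R\<^esub> k"
proof (induction k)
  interpret group "presented_group R" by (rule group_presented_group)
  case 0
  then show ?case by (simp add: word_pow_def one_presented_group)
next
  interpret group "presented_group R" by (rule group_presented_group)
  case (Suc k)
  have "word_class R (word_pow w (Suc k)) = word_class R w \<otimes>\<^bsub>presented_group R\<^esub> word_class R (word_pow w k)"
    by (simp add: word_pow_def)
  then show ?case
    using Suc.IH nat_pow_Suc2[of "word_class R w" k] by simp
qed

lemma word_class_inv:
  "word_class R (word_inv w) = inv\<^bsub>presented_group R\<^esub> word_class R w"
proof -
  interpret group "presented_group R" by (rule group_presented_group)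
  show ?thesis
    by (rule inv_equality[symmetric])
      (simp_all add: one_presented_group word_class_eq_iff word_equiv_inv_left)
qed

lemma word_class_relation:
  assumes "(u, v) \<in> R" shows "word_class R u = word_class R v"
  using word_equiv.relation[OF assms, of "[]" "[]"] by (simp add: word_class_eq_iff)

lemma carrier_presented_group_generate:
  "carrier (presented_group R) = generate (presented_group R) (range (\<lambda>x. word_class R (word_gen x)))"
    (is "_ = generate ?G ?X")
proof
  interpret group ?G by (rule group_presented_group)
  have X: "?X \<subseteq> carrier ?G" by auto
  show "generate ?G ?X \<subseteq> carrier ?G"
    using X by (rule generate_incl)
  have "word_class R w \<in> generate ?G ?X" for w
  proof (induction w)
    case Nil
    then show ?case by (metis generate.one one_presented_group)
  next
    case (Cons l w)
    obtain x b where l: "l = (x, b)" by (cases l)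
    have "word_class R [l] \<in> generate ?G ?X"
    proof (cases b)
      case True
      then have "word_class R [l] = word_class R (word_gen x)" by (simp add: l word_gen_def)
      then show ?thesis by (auto intro: generate.incl)
    next
      case False
      then have "word_class R [l] = inv\<^bsub>?G\<^esub> word_class R (word_gen x)"
        by (simp add: l word_class_inv[symmetric] word_inv_def word_gen_def)
      then show ?thesis by (auto intro: generate.inv)
    qed
    then have "word_class R [l] \<otimes>\<^bsub>?G\<^esub> word_class R w \<in> generate ?G ?X"
      using Cons.IH by (rule generate.eng)
    then show ?case by simp
  qed
  then show "carrier ?G \<subseteq> generate ?G ?X"
    by (auto simp: presented_group_def)
qed

definition word_ipow :: "'a \<Rightarrow> int \<Rightarrow> 'a gword" where
  "word_ipow x k = replicate (nat \<bar>k\<bar>) (x, k \<ge> 0)"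

lemma word_class_ipow:
  "word_class R (word_ipow x k) = word_class R (word_gen x) [^]\<^bsub>presented_group R\<^esub> k"
proof -
  interpret group "presented_group R" by (rule group_presented_group)
  have concat: "concat (replicate m [l]) = replicate m l" for m and l :: "'a \<times> bool"
    by (induction m) auto
  show ?thesis
  proof (cases "k \<ge> 0")
    case True
    then have "word_ipow x k = word_pow (word_gen x) (nat k)"
      by (simp add: word_ipow_def word_pow_def word_gen_def concat)
    then show ?thesis
      using True by (simp add: word_class_pow)
  next
    case False
    then have "word_ipow x k = word_pow (word_inv (word_gen x)) (nat (- k))"
      by (simp add: word_ipow_def word_pow_def word_gen_def word_inv_def concat)
    then show ?thesis
      using False by (simp add: word_class_pow word_class_inv int_pow_def2 nat_pow_inv del: pow_nat)
  qed
qed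

text \<open>The triple \<open>(c, a, b)\<close> stands for \<open>\<rho>\<^sup>c \<sigma>\<^sup>a \<tau>\<^sup>b\<close>, and a letter acts by multiplication from the
  right. Moving \<open>\<rho>\<close> or its inverse to the left past \<open>\<sigma>\<^sup>a \<tau>\<^sup>b\<close> turns it into \<open>\<sigma>\<^sup>3\<^sup>a \<tau>\<^sup>-\<^sup>b\<close> in both cases,
  because \<open>3\<close> is its own inverse modulo \<open>8\<close>.\<close>
fun act :: "gen \<times> bool \<Rightarrow> int \<times> int \<times> int \<Rightarrow> int \<times> int \<times> int" where
  "act (Sigma_gen, p) (c, a, b) = (c, a + (if p then 1 else -1), b)"
| "act (Tau_gen, p) (c, a, b) = (c, a, b + (if p then 1 else -1))"
| "act (Rho_gen, p) (c, a, b) = (c + (if p then 1 else -1), 3 * a, - b)"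

text \<open>The coincidences \<open>\<rho>\<^sup>c \<sigma>\<^sup>a \<tau>\<^sup>b = \<rho>\<^sup>c\<^sup>' \<sigma>\<^sup>a\<^sup>' \<tau>\<^sup>b\<^sup>'\<close> forced by the relations: trading \<open>\<rho>\<^sup>2\<close> for \<open>\<sigma>\<^sup>2 \<tau>\<^sup>2\<^sup>N\<close>
  changes neither \<open>c + a\<close> nor \<open>b - N a\<close>, and trading \<open>\<sigma>\<^sup>4\<close> for \<open>\<tau>\<^sup>4\<^sup>N\<close> changes \<open>c + a\<close> by \<open>4\<close> and
  \<open>b - N a\<close> by \<open>8 N\<close>.\<close>
fun same_exps :: "int \<Rightarrow> int \<times> int \<times> int \<Rightarrow> int \<times> int \<times> int \<Rightarrow> bool" where
  "same_exps N (c, a, b) (c', a', b') \<longleftrightarrow>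
     even (c - c') \<and> 4 dvd (c + a) - (c' + a') \<and> 8 * N dvd (b - N * a) - (b' - N * a')"

lemma same_exps_refl: "same_exps N s s"
  by (cases s) simp

lemma same_exps_sym: "same_exps N s s' \<Longrightarrow> same_exps N s' s"
proof -
  obtain c a b c' a' b' where s: "s = (c, a, b)" "s' = (c', a', b')"
    by (metis prod_cases3)
  show "same_exps N s s' \<Longrightarrow> same_exps N s' s"
    using dvd_diff_commute unfolding s same_exps.simps by metis
qed

lemma same_exps_trans: "same_exps N s s' \<Longrightarrow> same_exps N s' s'' \<Longrightarrow> same_exps N s s''"
proof -
  obtain c a b c' a' b' c'' a'' b'' where s: "s = (c, a, b)" "s' = (c', a', b')" "s'' = (c'', a'', b'')"
    by (metis prod_cases3)
  have tr: "d dvd x - y \<Longrightarrow> d dvd y - z \<Longrightarrow> d dvd x - z" for d x y z :: int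
    using dvd_add[of d "x - y" "y - z"] by simp
  show "same_exps N s s' \<Longrightarrow> same_exps N s' s'' \<Longrightarrow> same_exps N s s''"
    using tr unfolding s same_exps.simps by blast
qed

text \<open>The only delicate letter is \<open>\<rho>\<close>: it maps a difference \<open>(2 i, 4 j - 2 i, N (4 j - 2 i) + 8 N k)\<close> of exponents
  to one in which \<open>b - N a\<close> differs by \<open>- 4 N (4 j - 2 i) - 8 N k\<close>, again a multiple of \<open>8 N\<close>.\<close>
lemma same_exps_act:
  assumes "same_exps N s s'" shows "same_exps N (act l s) (act l s')"
proof -
  obtain c a b c' a' b' where s: "s = (c, a, b)" "s' = (c', a', b')"
    by (metis prod_cases3)
  obtain x p where l: "l = (x, p)" by (cases l)
  from assms obtain i j k where "c - c' = 2 * i" "(c + a) - (c' + a') = 4 * j"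
      "(b - N * a) - (b' - N * a') = 8 * N * k"
    unfolding s same_exps.simps dvd_def by blast
  then have c: "c = c' + 2 * i" and a: "a = a' + 4 * j - 2 * i"
    and "b = b' + N * (a - a') + 8 * N * k"
    by (simp_all add: algebra_simps)
  then have b: "b = b' + N * (4 * j - 2 * i) + 8 * N * k"
    by simp
  show ?thesis
  proof (cases x)
    case Rho_gen
    have "4 dvd (2 * i + 3 * (4 * j - 2 * i))"
      by presburger
    moreover have "- (N * (4 * j - 2 * i) + 8 * N * k) - N * (3 * (4 * j - 2 * i)) = 8 * N * (i - 2 * j - k)"
      by (simp add: algebra_simps)
    ultimately show ?thesis
      unfolding s l Rho_gen a b c by (auto simp: algebra_simps)
  qed (use assms in \<open>auto simp: s l algebra_simps\<close>)
qed

lemma same_exps_fold: "same_exps N s s' \<Longrightarrow> same_exps N (fold act w s) (fold act w s')"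
  by (induction w arbitrary: s s') (simp_all add: same_exps_act)

lemma act_sigma_funpow:
  "(act (Sigma_gen, p) ^^ k) (c, a, b) = (c, a + (if p then int k else - int k), b)"
  by (induction k) auto

lemma act_tau_funpow:
  "(act (Tau_gen, p) ^^ k) (c, a, b) = (c, a, b + (if p then int k else - int k))"
  by (induction k) auto

lemma act_rho_funpow:
  "(act (Rho_gen, p) ^^ k) (c, a, b) = (c + (if p then int k else - int k), 3 ^ k * a, (- 1) ^ k * b)"
  by (induction k) auto

lemma fold_act_relation:
  assumes "n \<ge> 1" and uv: "(u, v) \<in> G_relations n"
  shows "same_exps (2 ^ (n - 1)) (fold act u s) (fold act v s)"
proof -
  obtain c a b where s: "s = (c, a, b)" by (metis prod_cases3)
  obtain m where n: "n = Suc m" using assms(1) by (cases n) auto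
  have pow1: "word_pow [l] k = replicate k l" for k and l :: "gen \<times> bool"
    unfolding word_pow_def by (induction k) auto
  have "4 dvd 80 * a" "4 dvd 8 * a" by presburger+
  then show ?thesis
    using uv unfolding G_relations_def Let_def word_gen_def word_comm_def word_inv_def
    by (auto simp: n s pow1 act_sigma_funpow act_tau_funpow act_rho_funpow algebra_simps)
qed

text \<open>Up to \<open>same_exps\<close>, the triple reached from \<open>(0, 0, 0)\<close> thus depends only on the element of the presented group,
  which keeps normal forms with different invariants apart.\<close>
lemma fold_act_word_equiv:
  assumes "n \<ge> 1"
  shows "word_equiv (G_relations n) u v \<Longrightarrow> same_exps (2 ^ (n - 1)) (fold act u s) (fold act v s)"
proof (induction arbitrary: s rule: word_equiv.induct)
  case (cancel u x b v)
  obtain c a d where s: "fold act u s = (c, a, d)" by (metis prod_cases3)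
  have "same_exps (2 ^ (n - 1)) (act (x, \<not> b) (act (x, b) (c, a, d))) (c, a, d)"
    by (cases x) auto
  then show ?case
    by (auto simp: s intro: same_exps_fold)
next
  case (relation r s' u v)
  show ?case
    using same_exps_fold[OF fold_act_relation[OF assms relation]] by simp
next
  case (trans u v w)
  then show ?case by (meson same_exps_trans)
qed (simp_all add: same_exps_refl same_exps_sym)

section \<open>Normal forms\<close>

text \<open>Conjugation by \<open>z\<close> is compatible with powers. With \<open>x = y\<close> this says that powers of commuting
  elements commute.\<close>
lemma (in group) int_pow_intertwine:
  fixes i :: int
  assumes x: "x \<in> carrier G" and y: "y \<in> carrier G" and z: "z \<in> carrier G"
    and eq: "x \<otimes> z = z \<otimes> y"
  shows "x [^] i \<otimes> z = z \<otimes> y [^] i"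
proof -
  have nat: "x [^] k \<otimes> z = z \<otimes> y [^] k" for k :: nat
  proof (induction k)
    case (Suc k)
    have "x [^] Suc k \<otimes> z = x [^] k \<otimes> (x \<otimes> z)"
      using x z by (simp add: m_assoc)
    also have "\<dots> = x [^] k \<otimes> z \<otimes> y"
      using x y z by (simp add: eq m_assoc)
    also have "\<dots> = z \<otimes> y [^] Suc k"
      using y z Suc.IH by (simp add: m_assoc)
    finally show ?case .
  qed (use z in simp)
  show ?thesis
  proof (cases "i \<ge> 0")
    case True
    then show ?thesis
      using nat[of "nat i"] by simp
  next
    case False
    define k where "k = nat (- i)"
    have i: "i = - int k"
      using False by (simp add: k_def)
    have "inv (x [^] k) \<otimes> z = inv (x [^] k) \<otimes> (z \<otimes> y [^] k) \<otimes> inv (y [^] k)"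
      using x y z by (simp add: m_assoc)
    also have "\<dots> = z \<otimes> inv (y [^] k)"
      unfolding nat[symmetric] using x y z by (simp add: m_assoc[symmetric])
    finally have "inv (x [^] k) \<otimes> z = z \<otimes> inv (y [^] k)" .
    then show ?thesis
      using x y by (simp add: i int_pow_neg_int)
  qed
qed

text \<open>What the presentation provides, in a form free of words; \<open>N\<close> stands for \<open>2 ^ (n - 1)\<close>. The last assumption is the only one that bounds the group from below.\<close>
locale normal_form_group = group G for G (structure) +
  fixes N :: int and s t r :: 'a
  assumes N_pos: "N \<ge> 1"
    and s: "s \<in> carrier G" and t: "t \<in> carrier G" and r: "r \<in> carrier G"
    and s8: "s [^] (8::int) = \<one>" and t8N: "t [^] (8 * N) = \<one>"
    and s4: "s [^] (4::int) = t [^] (4 * N)"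
    and r2: "r [^] (2::int) = t [^] (2 * N) \<otimes> s [^] (2::int)"
    and ts: "t \<otimes> s = s \<otimes> t"
    and sr: "s \<otimes> r = r \<otimes> s [^] (3::int)"
    and tr: "t \<otimes> r = r \<otimes> inv t"
    and gen: "carrier G = generate G {s, t, r}"
    and faithful: "r [^] (c::int) \<otimes> (s [^] (a::int) \<otimes> t [^] (b::int)) =
        r [^] (c'::int) \<otimes> (s [^] (a'::int) \<otimes> t [^] (b'::int)) \<Longrightarrow> same_exps N (c, a, b) (c', a', b')"
begin

definition nf :: "int \<Rightarrow> int \<Rightarrow> int \<Rightarrow> 'a" where
  "nf c a b = r [^] c \<otimes> (s [^] a \<otimes> t [^] b)"

lemma nf_closed [simp]: "nf c a b \<in> carrier G"
  using s t r by (simp add: nf_def)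

lemma s_t_commute: "t [^] (b::int) \<otimes> s [^] (a::int) = s [^] a \<otimes> t [^] b"
proof -
  have "s [^] a \<otimes> t = t \<otimes> s [^] a"
    using ts by (intro int_pow_intertwine s t) simp
  then show ?thesis
    by (intro int_pow_intertwine) (simp_all add: s t)
qed

lemma nf_mult_st: "nf c a b \<otimes> (s [^] a' \<otimes> t [^] b') = nf c (a + a') (b + b')"
proof -
  have "(s [^] a \<otimes> t [^] b) \<otimes> (s [^] a' \<otimes> t [^] b') = s [^] a \<otimes> (t [^] b \<otimes> s [^] a') \<otimes> t [^] b'"
    using s t by (simp add: m_assoc)
  also have "\<dots> = (s [^] a \<otimes> s [^] a') \<otimes> (t [^] b \<otimes> t [^] b')"
    unfolding s_t_commute using s t by (simp add: m_assoc)
  finally show ?thesis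
    using s t r by (simp add: nf_def int_pow_mult m_assoc)
qed

lemma nf_mult_r: "nf c a b \<otimes> r = nf (c + 1) (3 * a) (- b)"
proof -
  have "s [^] a \<otimes> r = r \<otimes> s [^] (3 * a)"
    using int_pow_intertwine[OF s _ r sr, of a] s by (simp add: int_pow_pow)
  moreover have "t [^] b \<otimes> r = r \<otimes> t [^] (- b)"
    using int_pow_intertwine[OF t _ r tr, of b] t by (simp add: int_pow_inv int_pow_neg)
  ultimately have "(s [^] a \<otimes> t [^] b) \<otimes> r = r \<otimes> (s [^] (3 * a) \<otimes> t [^] (- b))"
    using s t r by (metis int_pow_closed m_assoc)
  then show ?thesis
    using s t r by (simp add: nf_def int_pow_mult m_assoc)
qed

lemma s_pow_period: "s [^] (a + 8 * k :: int) = s [^] a"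
  using s by (simp add: int_pow_mult int_pow_pow[symmetric] s8)

text \<open>\<open>\<rho>\<^sup>2\<close> is central, as conjugating twice sends \<open>\<sigma>\<close> to \<open>\<sigma>\<^sup>9 = \<sigma>\<close>.\<close>
lemma nf_mult_r_even:
  assumes "even d" shows "nf c a b \<otimes> r [^] d = nf (c + d) a b"
proof -
  obtain k where d: "d = 2 * k" using assms by blast
  have rr: "r [^] (2::int) = r \<otimes> r"
    using r int_pow_mult[of r 1 1] by simp
  have "(s [^] a \<otimes> t [^] b) \<otimes> r [^] (2::int) = nf 0 a b \<otimes> r \<otimes> r"
    using s t r by (simp add: nf_def rr m_assoc)
  also have "\<dots> = r [^] (2::int) \<otimes> (s [^] (9 * a) \<otimes> t [^] b)"
    unfolding nf_mult_r by (simp add: nf_def)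
  also have "s [^] (9 * a) = s [^] a"
    using s_pow_period[of a a] by simp
  finally have "r [^] (2::int) \<otimes> (s [^] a \<otimes> t [^] b) = (s [^] a \<otimes> t [^] b) \<otimes> r [^] (2::int)" ..
  then have "r [^] d \<otimes> (s [^] a \<otimes> t [^] b) = (s [^] a \<otimes> t [^] b) \<otimes> r [^] d"
    using int_pow_intertwine[of "r [^] (2::int)" "r [^] (2::int)" "s [^] a \<otimes> t [^] b" k] s t r
    by (simp add: d int_pow_pow)
  then show ?thesis
    using s t r by (simp add: nf_def int_pow_mult m_assoc)
qed

lemma nf_mult:
  "nf c a b \<otimes> nf c' a' b' =
     nf (c + c') ((if even c' then a else 3 * a) + a') ((if even c' then b else - b) + b')"
proof -
  have "nf c a b \<otimes> r [^] c' = nf (c + c') (if even c' then a else 3 * a) (if even c' then b else - b)"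
  proof (cases "even c'")
    case False
    have "nf c a b \<otimes> r [^] c' = nf c a b \<otimes> r \<otimes> r [^] (c' - 1)"
      using r int_pow_mult[of r 1 "c' - 1"] by (simp add: m_assoc)
    then show ?thesis
      using False by (simp add: nf_mult_r nf_mult_r_even)
  qed (simp add: nf_mult_r_even)
  then have "nf c a b \<otimes> r [^] c' \<otimes> (s [^] a' \<otimes> t [^] b') =
      nf (c + c') ((if even c' then a else 3 * a) + a') ((if even c' then b else - b) + b')"
    by (simp only: nf_mult_st)
  then show ?thesis
    using s t r unfolding nf_def[of c' a' b'] by (simp add: m_assoc)
qed

lemma nf_one: "nf 0 0 0 = \<one>" and nf_s: "nf 0 1 0 = s" and nf_t: "nf 0 0 1 = t" and nf_r: "nf 1 0 0 = r"
  using s t r by (simp_all add: nf_def)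

text \<open>Write the difference of the exponents as \<open>\<rho>\<^sup>2\<^sup>i \<sigma>\<^sup>4\<^sup>j\<^sup>-\<^sup>2\<^sup>i \<tau>\<^sup>d\<close> and substitute \<open>\<rho>\<^sup>2 = \<tau>\<^sup>2\<^sup>N \<sigma>\<^sup>2\<close> and
  \<open>\<sigma>\<^sup>4 = \<tau>\<^sup>4\<^sup>N\<close>; what is left is a power of \<open>\<tau>\<^sup>8\<^sup>N\<close>.\<close>
lemma nf_eqI:
  assumes "same_exps N (c, a, b) (c', a', b')"
  shows "nf c a b = nf c' a' b'"
proof -
  obtain i j k where "c' - c = 2 * i" "(c' + a') - (c + a) = 4 * j"
      "(b' - N * a') - (b - N * a) = 8 * N * k"
    using same_exps_sym[OF assms] unfolding same_exps.simps dvd_def by blast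
  then have c: "c' = c + 2 * i" and a: "a' = a + 4 * j - 2 * i"
    and "b' = b + N * (a' - a) + 8 * N * k"
    by (simp_all add: algebra_simps)
  then have b: "b' = b + N * (4 * j - 2 * i) + 8 * N * k"
    by simp
  have r: "r [^] (2 * i) = nf 0 (2 * i) (2 * N * i)"
  proof -
    have "r [^] (2 * i) = (t [^] (2 * N) \<otimes> s [^] (2::int)) [^] i"
      using r by (simp add: int_pow_pow[symmetric] r2)
    then show ?thesis
      using s t by (simp add: int_pow_mult_distrib s_t_commute int_pow_pow nf_def)
  qed
  have j: "nf 0 (4 * j) (- (4 * N * j)) = \<one>"
    using s t by (simp add: nf_def int_pow_pow[symmetric] s4)
      (simp add: int_pow_pow flip: int_pow_mult)
  have "nf c' a' b' = nf c a b \<otimes> nf (2 * i) (4 * j - 2 * i) (N * (4 * j - 2 * i) + 8 * N * k)"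
    by (simp add: nf_mult a b c algebra_simps)
  also have "nf (2 * i) (4 * j - 2 * i) (N * (4 * j - 2 * i) + 8 * N * k) =
      nf 0 (2 * i) (2 * N * i) \<otimes> nf 0 (4 * j - 2 * i) (N * (4 * j - 2 * i) + 8 * N * k)"
    unfolding r[symmetric] by (simp add: nf_def s t)
  also have "\<dots> = nf 0 (4 * j) (- (4 * N * j)) \<otimes> nf 0 0 (8 * N * (j + k))"
    by (simp add: nf_mult algebra_simps)
  also have "nf 0 0 (8 * N * (j + k)) = \<one>"
    using t by (simp add: nf_def int_pow_pow[symmetric] t8N)
  finally show ?thesis
    by (simp add: j)
qed

lemma nf_eq_iff: "nf c a b = nf c' a' b' \<longleftrightarrow> same_exps N (c, a, b) (c', a', b')"
  using nf_eqI faithful unfolding nf_def by blast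

text \<open>On elements with even \<open>\<rho>\<close>-exponent, multiplication adds exponents.\<close>
lemma nf_pow_even:
  assumes "even c" shows "nf c a b [^] (i::int) = nf (i * c) (i * a) (i * b)"
proof -
  have nat: "nf c a b [^] k = nf (int k * c) (int k * a) (int k * b)" for k :: nat
    using assms by (induction k) (simp_all add: nf_one nf_mult algebra_simps)
  show ?thesis
  proof (cases "i \<ge> 0")
    case True
    then show ?thesis using nat[of "nat i"] by simp
  next
    case False
    define k where "k = nat (- i)"
    have i: "i = - int k"
      using False by (simp add: k_def)
    have "nf (i * c) (i * a) (i * b) \<otimes> nf c a b [^] k = \<one>"
      unfolding nat using assms by (simp add: i nf_mult nf_one)
    then show ?thesis
      by (simp add: i int_pow_neg_int inv_equality)
  qed
qed

lemma carrier_nf: "carrier G = {nf c a b | c a b. True}"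
proof
  let ?K = "{nf c a b | c a b. True}"
  have inv: "\<exists>c' a' b'. nf c' a' b' \<otimes> nf c a b = \<one>" for c a b
  proof (cases "even c")
    case True
    then have "nf (- c) (- a) (- b) \<otimes> nf c a b = \<one>"
      by (simp add: nf_mult nf_one)
    then show ?thesis by blast
  next
    case False
    have "nf (- c) (- 3 * a) b \<otimes> nf c a b = nf 0 (- 8 * a) 0"
      using False by (simp add: nf_mult)
    also have "\<dots> = \<one>"
      unfolding nf_one[symmetric] by (rule nf_eqI) (simp add: dvd_def)
    finally show ?thesis by blast
  qed
  have "subgroup ?K G"
  proof (rule subgroupI)
    show "inv x \<in> ?K" if xK: "x \<in> ?K" for x
    proof -
      obtain c a b where x: "x = nf c a b" using xK by blast
      obtain c' a' b' where "nf c' a' b' \<otimes> nf c a b = \<one>" using inv by blast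
      then have "inv x = nf c' a' b'" unfolding x by (simp add: inv_equality)
      then show ?thesis by blast
    qed
    show "x \<otimes> y \<in> ?K" if xyK: "x \<in> ?K" "y \<in> ?K" for x y
    proof -
      obtain c a b c' a' b' where "x = nf c a b" "y = nf c' a' b'" using xyK by blast
      then show ?thesis using nf_mult[of c a b c' a' b'] by blast
    qed
    show "?K \<subseteq> carrier G" using nf_closed by blast
    show "?K \<noteq> {}" by blast
  qed
  moreover have "{s, t, r} \<subseteq> ?K"
    using nf_s[symmetric] nf_t[symmetric] nf_r[symmetric] by blast
  ultimately show "carrier G \<subseteq> ?K"
    unfolding gen by (rule generate_subgroup_incl[rotated])
  show "?K \<subseteq> carrier G" using nf_closed by blast
qed

lemma carrier_nfE:
  assumes "x \<in> carrier G" obtains c a b where "x = nf c a b"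
  using assms carrier_nf by blast

section \<open>Normal subgroups of index four\<close>

text \<open>The fibers of the map to \<open>(\<int>/2)\<^sup>3\<close> that reduces the exponents modulo \<open>2\<close>. This map is well defined
  by \<open>same_exps_parity\<close> below.\<close>
definition parity_fiber :: "bool \<times> bool \<times> bool \<Rightarrow> 'a set" where
  "parity_fiber v = {nf c a b | c a b. (odd c, odd a, odd b) = v}"

abbreviation zero_parity :: "bool \<times> bool \<times> bool" where
  "zero_parity \<equiv> (False, False, False)"

definition parity_subgroup :: "bool \<times> bool \<times> bool \<Rightarrow> 'a set" where
  "parity_subgroup v = parity_fiber zero_parity \<union> parity_fiber v"

lemma same_exps_parity:
  assumes "same_exps N (c, a, b) (c', a', b')"
  shows "even c = even c'" "even a = even a'" "even b = even b'"
proof -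
  have c: "even (c - c')" and ac: "4 dvd (c + a) - (c' + a')"
    and b: "8 * N dvd (b - N * a) - (b' - N * a')"
    using assms by simp_all
  have "even ((c + a) - (c' + a'))"
    using ac by presburger
  then have a: "even (a - a')"
    using c by simp presburger
  have "even ((b - N * a) - (b' - N * a'))"
    using b by (rule dvd_trans[rotated]) simp
  then have "even ((b - b') - N * (a - a'))"
    by (simp add: algebra_simps)
  then have "even (b - b')"
    using a by simp
  then show "even c = even c'" "even a = even a'" "even b = even b'"
    using a c by simp_all
qed

lemma nf_in_fiber [simp]: "nf c a b \<in> parity_fiber v \<longleftrightarrow> v = (odd c, odd a, odd b)"
proof
  assume "nf c a b \<in> parity_fiber v"
  then obtain c' a' b' where "nf c a b = nf c' a' b'" and v: "v = (odd c', odd a', odd b')"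
    unfolding parity_fiber_def by blast
  then show "v = (odd c, odd a, odd b)"
    using same_exps_parity unfolding nf_eq_iff by blast
qed (auto simp: parity_fiber_def)

lemma nf_in_parity_subgroup [simp]:
  "nf c a b \<in> parity_subgroup v \<longleftrightarrow> (odd c, odd a, odd b) = zero_parity \<or> (odd c, odd a, odd b) = v"
  by (auto simp: parity_subgroup_def)

lemma fiber_closed: "parity_fiber v \<subseteq> carrier G"
  unfolding parity_fiber_def using nf_closed by blast

lemma parity_subgroup_closed: "parity_subgroup v \<subseteq> carrier G"
  unfolding parity_subgroup_def using fiber_closed by blast

lemma fiberE:
  assumes "x \<in> parity_fiber v" obtains c a b where "x = nf c a b" "v = (odd c, odd a, odd b)"
  using assms unfolding parity_fiber_def by blast

lemma parity_subgroupE: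
  assumes "x \<in> parity_subgroup v"
  obtains c a b where "x = nf c a b" "(odd c, odd a, odd b) = zero_parity \<or> (odd c, odd a, odd b) = v"
  using assms unfolding parity_subgroup_def parity_fiber_def by blast

lemma inv_nfE:
  obtains c' a' b' where "inv (nf c a b) = nf c' a' b'" "(odd c', odd a', odd b') = (odd c, odd a, odd b)"
proof -
  obtain c' a' b' where i: "inv (nf c a b) = nf c' a' b'"
    using carrier_nfE[OF inv_closed[OF nf_closed]] by blast
  then have "nf c' a' b' \<otimes> nf c a b = nf 0 0 0"
    by (metis nf_closed nf_one l_inv)
  then have "same_exps N (c' + c, (if even c then a' else 3 * a') + a, (if even c then b' else - b') + b) (0, 0, 0)"
    unfolding nf_mult nf_eq_iff .
  from same_exps_parity[OF this] have "(odd c', odd a', odd b') = (odd c, odd a, odd b)"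
    by (auto split: if_splits)
  then show thesis
    using i that by simp
qed

lemma subgroup_parity_subgroup: "subgroup (parity_subgroup v) G"
proof (rule subgroupI)
  show "parity_subgroup v \<subseteq> carrier G" by (rule parity_subgroup_closed)
  have "nf 0 0 0 \<in> parity_subgroup v" by simp
  then show "parity_subgroup v \<noteq> {}" by blast
next
  fix x assume "x \<in> parity_subgroup v"
  then obtain c a b where x: "x = nf c a b"
    and p: "(odd c, odd a, odd b) = zero_parity \<or> (odd c, odd a, odd b) = v"
    by (rule parity_subgroupE)
  obtain c' a' b' where "inv x = nf c' a' b'" "(odd c', odd a', odd b') = (odd c, odd a, odd b)"
    unfolding x by (rule inv_nfE)
  then show "inv x \<in> parity_subgroup v"
    using p by simp
next
  fix x y assume "x \<in> parity_subgroup v" "y \<in> parity_subgroup v"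
  then obtain c a b c' a' b' where x: "x = nf c a b" and y: "y = nf c' a' b'"
    and "(odd c, odd a, odd b) = zero_parity \<or> (odd c, odd a, odd b) = v"
    and "(odd c', odd a', odd b') = zero_parity \<or> (odd c', odd a', odd b') = v"
    by (elim parity_subgroupE)
  then show "x \<otimes> y \<in> parity_subgroup v"
    by (cases v) (auto simp: nf_mult)
qed

lemma normal_parity_subgroup: "parity_subgroup v \<lhd> G"
proof (rule normal_invI[OF subgroup_parity_subgroup])
  fix x h assume "x \<in> carrier G" and "h \<in> parity_subgroup v"
  then obtain c a b c' a' b' where x: "x = nf c a b" and h: "h = nf c' a' b'"
    and p: "(odd c', odd a', odd b') = zero_parity \<or> (odd c', odd a', odd b') = v"
    by (elim carrier_nfE parity_subgroupE)
  obtain c'' a'' b'' where i: "inv x = nf c'' a'' b''" and q: "(odd c'', odd a'', odd b'') = (odd c, odd a, odd b)"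
    unfolding x by (rule inv_nfE)
  show "x \<otimes> h \<otimes> inv x \<in> parity_subgroup v"
    unfolding i unfolding x h nf_mult using p q by (cases v) auto
qed

lemma finite_carrier: "finite (carrier G)"
proof -
  let ?B = "(\<lambda>(c, a, b). nf c a b) ` ({0..<2} \<times> {0..<4} \<times> {0..<8 * N})"
  have "carrier G \<subseteq> ?B"
  proof
    fix x assume "x \<in> carrier G"
    then obtain c a b where x: "x = nf c a b" by (rule carrier_nfE)
    \<comment> \<open>The exponents of \<open>x\<close> can be reduced to the box, first \<open>c\<close>, then \<open>a\<close>, then \<open>b\<close>, keeping the three invariants.\<close>
    define c' a' where "c' = c mod 2" and "a' = (c + a - c') mod 4"
    define b' where "b' = (b - N * a + N * a') mod (8 * N)"
    have "8 * N dvd (b - N * a + N * a') - b'"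
      unfolding b'_def by simp
    moreover have "4 dvd (c + a) - (c' + a')"
      unfolding a'_def by presburger
    moreover have "even (c - c')"
      unfolding c'_def by simp
    ultimately have "x = nf c' a' b'"
      unfolding x nf_eq_iff by (simp add: algebra_simps)
    moreover have "c' \<in> {0..<2}" "a' \<in> {0..<4}" "b' \<in> {0..<8 * N}"
      using N_pos by (simp_all add: c'_def a'_def b'_def)
    ultimately show "x \<in> ?B" by force
  qed
  then show ?thesis
    by (rule finite_subset) simp
qed

text \<open>The fibers are the cosets of the kernel; hence they all have the same size.\<close>
lemma fiber_eq_l_coset:
  assumes "x \<in> parity_fiber v"
  shows "parity_fiber v = (\<lambda>y. x \<otimes> y) ` parity_fiber zero_parity"
proof
  obtain c a b where x: "x = nf c a b" and v: "v = (odd c, odd a, odd b)"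
    using assms by (rule fiberE)
  show "(\<lambda>y. x \<otimes> y) ` parity_fiber zero_parity \<subseteq> parity_fiber v"
    by (auto simp: x v nf_mult elim!: fiberE)
  show "parity_fiber v \<subseteq> (\<lambda>y. x \<otimes> y) ` parity_fiber zero_parity"
  proof
    fix z assume "z \<in> parity_fiber v"
    then obtain c'' a'' b'' where z: "z = nf c'' a'' b''" and v': "v = (odd c'', odd a'', odd b'')"
      by (rule fiberE)
    obtain c' a' b' where i: "inv x = nf c' a' b'" and p: "(odd c', odd a', odd b') = (odd c, odd a, odd b)"
      unfolding x by (rule inv_nfE)
    have "inv x \<otimes> z \<in> parity_fiber zero_parity"
      unfolding i unfolding z nf_mult using p v v' by auto
    moreover have "z = x \<otimes> (inv x \<otimes> z)"
      using x z by (simp add: m_assoc[symmetric])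
    ultimately show "z \<in> (\<lambda>y. x \<otimes> y) ` parity_fiber zero_parity" by blast
  qed
qed

lemma card_fiber: "card (parity_fiber v) = card (parity_fiber zero_parity)"
proof -
  obtain p q u where v: "v = (p, q, u)" by (metis prod_cases3)
  have x: "nf (of_bool p) (of_bool q) (of_bool u) \<in> parity_fiber v"
    by (simp add: v)
  show ?thesis
    unfolding fiber_eq_l_coset[OF x] using fiber_closed
    by (intro card_image inj_on_subset[OF inj_on_cmult]) simp_all
qed

lemma finite_fiber: "finite (parity_fiber v)"
  using finite_carrier fiber_closed finite_subset by blast

lemma fibers_disjoint:
  assumes "v \<noteq> w" shows "parity_fiber v \<inter> parity_fiber w = {}"
proof -
  have False if "x \<in> parity_fiber v" "x \<in> parity_fiber w" for x
    using that assms by (metis fiberE nf_in_fiber)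
  then show ?thesis by blast
qed

lemma card_fiber_pos: "card (parity_fiber zero_parity) > 0"
proof -
  have "nf 0 0 0 \<in> parity_fiber zero_parity" by simp
  then show ?thesis
    using finite_fiber by (metis card_gt_0_iff empty_iff)
qed

lemma order_eq: "order G = 8 * card (parity_fiber zero_parity)"
proof -
  have "carrier G = (\<Union>v. parity_fiber v)"
    using fiber_closed by (auto elim!: carrier_nfE)
  then have "order G = (\<Sum>v\<in>UNIV. card (parity_fiber v))"
    unfolding order_def using finite_fiber fibers_disjoint
    by (simp add: card_UN_disjoint)
  also have "\<dots> = (\<Sum>v\<in>(UNIV :: (bool \<times> bool \<times> bool) set). card (parity_fiber zero_parity))"
    by (rule sum.cong[OF HOL.refl card_fiber])
  also have "\<dots> = 8 * card (parity_fiber zero_parity)"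
    by (simp add: card_UNIV_bool flip: UNIV_Times_UNIV)
  finally show ?thesis .
qed

lemma card_parity_subgroup:
  "v \<noteq> zero_parity \<Longrightarrow> card (parity_subgroup v) = 2 * card (parity_fiber zero_parity)"
  unfolding parity_subgroup_def using finite_fiber fibers_disjoint[of zero_parity v] card_fiber[of v]
  by (simp add: card_Un_disjoint)

lemma card_rcosets_eq_4_iff:
  assumes "subgroup H G"
  shows "card (rcosets H) = 4 \<longleftrightarrow> card H = 2 * card (parity_fiber zero_parity)"
  using lagrange[OF assms] order_eq card_fiber_pos by auto

text \<open>An even power of \<open>\<rho>\<close> can be traded for powers of \<open>\<sigma>\<^sup>2\<close> and \<open>\<tau>\<^sup>2\<close>, so these two generate the kernel of
  the reduction modulo \<open>2\<close>.\<close>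
lemma zero_fiber_subset:
  assumes K: "subgroup K G" and s2K: "s [^] (2::int) \<in> K" and t2K: "t [^] (2::int) \<in> K"
  shows "parity_fiber zero_parity \<subseteq> K"
proof
  fix x assume "x \<in> parity_fiber zero_parity"
  then obtain c a b where x: "x = nf c a b" and "even c" "even a" "even b"
    by (auto elim!: fiberE)
  then obtain i j k where e: "c = 2 * i" "a = 2 * j" "b = 2 * k"
    by (auto elim!: evenE)
  have "x = nf 0 (2 * (i + j)) (2 * (k + N * i))"
    unfolding x e nf_eq_iff by (simp add: algebra_simps)
  also have "\<dots> = (s [^] (2::int)) [^] (i + j) \<otimes> (t [^] (2::int)) [^] (k + N * i)"
    using s t by (simp add: nf_def int_pow_pow)
  also have "\<dots> \<in> K"
    using subgroup_int_pow_closed[OF K s2K] subgroup_int_pow_closed[OF K t2K]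
    by (rule subgroup.m_closed[OF K])
  finally show "x \<in> K" .
qed

lemma fiber_subset:
  assumes K: "subgroup K G" and 0: "parity_fiber zero_parity \<subseteq> K" and x: "x \<in> K" "x \<in> parity_fiber v"
  shows "parity_subgroup v \<subseteq> K"
  using 0 x subgroup.m_closed[OF K] unfolding parity_subgroup_def fiber_eq_l_coset[OF x(2)] by auto

text \<open>Groups of order \<open>4\<close> are abelian, so the commutators of \<open>\<rho>\<close> with \<open>\<sigma>\<close> and with \<open>\<tau>\<close> lie in \<open>H\<close>; up to
  sign of the exponent these are \<open>\<sigma>\<^sup>2\<close> and \<open>\<tau>\<^sup>2\<close>.\<close>
lemma index_4_contains_zero_fiber:
  assumes "H \<lhd> G" and "card (rcosets H) = 4"
  shows "parity_fiber zero_parity \<subseteq> H"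
proof -
  interpret H: normal H G by fact
  have "nf 1 0 0 \<otimes> nf 0 1 0 = nf 0 2 0 \<otimes> (nf 0 1 0 \<otimes> nf 1 0 0)"
    by (simp add: nf_mult nf_eq_iff)
  then have "nf 0 2 0 \<in> H"
    using assms by (intro commute_up_to_normal[OF assms, of "nf 1 0 0" "nf 0 1 0"]) simp_all
  moreover have "nf 1 0 0 \<otimes> nf 0 0 1 = nf 0 0 (-2) \<otimes> (nf 0 0 1 \<otimes> nf 1 0 0)"
    by (simp add: nf_mult)
  then have "nf 0 0 (-2) \<in> H"
    using assms by (intro commute_up_to_normal[OF assms, of "nf 1 0 0" "nf 0 0 1"]) simp_all
  then have "inv (nf 0 0 (-2)) \<in> H" by simp
  moreover have "inv (nf 0 0 (-2)) = nf 0 0 2"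
    by (rule inv_equality) (simp_all add: nf_mult nf_one)
  ultimately show ?thesis
    using s t by (intro zero_fiber_subset[OF H.subgroup_axioms]) (simp_all add: nf_def)
qed

text \<open>A normal subgroup of index \<open>4\<close> contains the kernel of the reduction modulo \<open>2\<close> and is twice as large,
  so any further element fills it up with one more fiber.\<close>
lemma normal_index_4_eq:
  "{H. H \<lhd> G \<and> card (rcosets H) = 4} = parity_subgroup ` (- {zero_parity})"
proof (intro equalityI subsetI)
  fix H assume "H \<in> {H. H \<lhd> G \<and> card (rcosets H) = 4}"
  then have H: "H \<lhd> G" "card (rcosets H) = 4" by simp_all
  interpret H: normal H G by fact
  let ?p = "card (parity_fiber zero_parity)"
  have cardH: "card H = 2 * ?p"
    using card_rcosets_eq_4_iff[OF H.subgroup_axioms] H(2) by simp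
  have "\<not> H \<subseteq> parity_fiber zero_parity"
  proof
    assume "H \<subseteq> parity_fiber zero_parity"
    then have "card H \<le> ?p"
      by (rule card_mono[OF finite_fiber])
    then show False
      using cardH card_fiber_pos by linarith
  qed
  then obtain x where x: "x \<in> H" "x \<notin> parity_fiber zero_parity" by blast
  obtain c a b where nf: "x = nf c a b"
    using H.mem_carrier[OF x(1)] by (rule carrier_nfE)
  define v where "v = (odd c, odd a, odd b)"
  have v: "v \<noteq> zero_parity" "x \<in> parity_fiber v"
    using x(2) unfolding nf v_def by auto
  have "parity_subgroup v \<subseteq> H"
    using fiber_subset[OF H.subgroup_axioms index_4_contains_zero_fiber[OF H] x(1) v(2)] .
  then have "parity_subgroup v = H"
    using cardH card_parity_subgroup[OF v(1)]
    by (intro card_subset_eq finite_subset[OF H.subset finite_carrier]) simp_all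
  then show "H \<in> parity_subgroup ` (- {zero_parity})"
    using v(1) by blast
next
  fix H assume "H \<in> parity_subgroup ` (- {zero_parity})"
  then obtain v where v: "v \<noteq> zero_parity" "H = parity_subgroup v" by blast
  then show "H \<in> {H. H \<lhd> G \<and> card (rcosets H) = 4}"
    using normal_parity_subgroup subgroup_parity_subgroup card_rcosets_eq_4_iff card_parity_subgroup
    by simp
qed

lemma inj_parity_subgroup: "inj_on parity_subgroup (- {zero_parity})"
proof (rule inj_onI)
  fix v w assume v: "v \<in> - {zero_parity}" and eq: "parity_subgroup v = parity_subgroup w"
  obtain p q u where pqu: "v = (p, q, u)" by (metis prod_cases3)
  have "nf (of_bool p) (of_bool q) (of_bool u) \<in> parity_subgroup v"
    by (simp add: pqu)
  then show "v = w"
    using v unfolding eq by (auto simp: pqu)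
qed

lemma parity_UNIV:
  "- {zero_parity} = {(False, True, False), (False, False, True), (True, False, False),
     (False, True, True), (True, True, False), (True, False, True), (True, True, True)}"
  by auto

text \<open>To identify a subgroup given by generators it thus suffices to find \<open>\<sigma>\<^sup>2\<close> and \<open>\<tau>\<^sup>2\<close> in it.\<close>
lemma generate_eq_parity_subgroup:
  assumes x: "x \<in> parity_fiber v" and y: "y \<in> parity_fiber zero_parity"
    and s2: "nf 0 2 0 \<in> generate G {x, y}" and t2: "nf 0 0 2 \<in> generate G {x, y}"
  shows "generate G {x, y} = parity_subgroup v"
proof
  have xy: "{x, y} \<subseteq> carrier G"
    using x y fiber_closed by blast
  show "generate G {x, y} \<subseteq> parity_subgroup v"
    using x y by (intro generate_subgroup_incl subgroup_parity_subgroup) (auto simp: parity_subgroup_def)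
  have K: "subgroup (generate G {x, y}) G"
    using xy by (rule generate_is_subgroup)
  show "parity_subgroup v \<subseteq> generate G {x, y}"
    using s2 t2 s t by (intro fiber_subset[OF K zero_fiber_subset[OF K] _ x])
      (auto simp: nf_def intro: generate.incl)
qed

section \<open>Derived subgroups and abelianizations\<close>

lemma even_parity_subgroupE:
  assumes "x \<in> parity_subgroup (False, p, q)"
  obtains c a b where "x = nf c a b" "even c"
  using assms by (rule parity_subgroupE) (use that in auto)

lemma derived_even:
  assumes "H = parity_subgroup (False, p, q)"
  shows "derived G H = {\<one>}"
proof -
  have comm: "x \<otimes> y \<otimes> inv x \<otimes> inv y = \<one>" if xy: "x \<in> H" "y \<in> H" for x y
  proof -
    obtain c a b c' a' b' where x: "x = nf c a b" and y: "y = nf c' a' b'" and "even c" "even c'"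
      using xy unfolding assms by (elim even_parity_subgroupE)
    then have "x \<otimes> y = y \<otimes> x"
      by (simp add: nf_mult add.commute)
    then have "x \<otimes> y \<otimes> inv x \<otimes> inv y = y \<otimes> (x \<otimes> inv x) \<otimes> inv y"
      by (simp add: x y m_assoc)
    then show ?thesis
      by (simp add: x y)
  qed
  have "\<one> \<in> H"
    unfolding assms by (rule subgroup.one_closed[OF subgroup_parity_subgroup])
  then have "derived_set G H = {\<one>}"
    using comm by force
  then show ?thesis
    unfolding derived_def by (metis generate_one)
qed

lemma generate_t4_eq: "generate G {t [^] (4::int)} = {nf 0 0 (4 * k) | k. True}"
  using t generate_pow[of "t [^] (4::int)"] by (simp add: nf_def int_pow_pow)

text \<open>Since \<open>4\<close> divides \<open>8 N\<close>, passing to the quotient by \<open>\<langle>\<tau>\<^sup>4\<rangle>\<close> weakens the congruence modulo \<open>8 N\<close> in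
  \<open>same_exps\<close> to one modulo \<open>4\<close>.\<close>
lemma nf_in_generate_t4:
  "nf c a b \<in> generate G {t [^] (4::int)} \<longleftrightarrow> even c \<and> 4 dvd c + a \<and> 4 dvd b - N * a"
proof
  assume "nf c a b \<in> generate G {t [^] (4::int)}"
  then obtain k where "nf c a b = nf 0 0 (4 * k)"
    unfolding generate_t4_eq by blast
  then have *: "even c" "4 dvd c + a" "8 * N dvd b - N * a - 4 * k"
    unfolding nf_eq_iff by simp_all
  have "4 dvd b - N * a - 4 * k"
    using *(3) by (rule dvd_trans[rotated]) simp
  then have "4 dvd b - N * a - 4 * k + 4 * k"
    by (intro dvd_add) simp_all
  then show "even c \<and> 4 dvd c + a \<and> 4 dvd b - N * a"
    using * by simp
next
  assume *: "even c \<and> 4 dvd c + a \<and> 4 dvd b - N * a"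
  then obtain k where "b - N * a = 4 * k" by blast
  then have "nf c a b = nf 0 0 (4 * k)"
    using * unfolding nf_eq_iff by simp
  then show "nf c a b \<in> generate G {t [^] (4::int)}"
    unfolding generate_t4_eq by blast
qed

text \<open>By the multiplication formula the exponents of \<open>x y\<close> and \<open>y x\<close> differ by multiples of \<open>4\<close>. If only
  \<open>x\<close> has an even \<open>\<rho>\<close>-exponent, the differences are \<open>2 a\<close> and \<open>- 2 b\<close>, with \<open>a\<close> and \<open>b\<close> even; if both
  \<open>\<rho>\<close>-exponents are odd, they are \<open>2 (a - a')\<close> and \<open>- 2 (b - b')\<close>, and \<open>x\<close>, \<open>y\<close> have equal parities. As
  \<open>\<sigma>\<^sup>4\<close> is a power of \<open>\<tau>\<^sup>4\<close>, all commutators are powers of \<open>\<tau>\<^sup>4\<close>. Conversely, conjugation by an element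
  with odd \<open>\<rho>\<close>-exponent inverts \<open>\<tau>\<^sup>2\<close>, which gives the commutator \<open>\<tau>\<^sup>4\<close>.\<close>
lemma derived_odd:
  assumes H: "H = parity_subgroup (True, p, q)"
  shows "derived G H = generate G {t [^] (4::int)}"
proof
  let ?D = "generate G {t [^] (4::int)}"
  have t4: "t [^] (4::int) = nf 0 0 4"
    using t by (simp add: nf_def s)
  have D: "subgroup ?D G"
    using t by (intro generate_is_subgroup) simp
  have comm: "x \<otimes> y \<otimes> inv x \<otimes> inv y \<in> ?D" if xy: "x \<in> H" "y \<in> H" for x y
  proof -
    obtain c a b c' a' b' where x: "x = nf c a b" and y: "y = nf c' a' b'"
      and px: "(odd c, odd a, odd b) = zero_parity \<or> (odd c, odd a, odd b) = (True, p, q)"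
      and py: "(odd c', odd a', odd b') = zero_parity \<or> (odd c', odd a', odd b') = (True, p, q)"
      using xy unfolding H by (elim parity_subgroupE)
    define A where "A = (if even c' then a else 3 * a) + a'"
    define A' where "A' = (if even c then a' else 3 * a') + a"
    define B where "B = (if even c' then b else - b) + b'"
    define B' where "B' = (if even c then b' else - b') + b"
    have xy: "x \<otimes> y = nf (c + c') A B" and yx: "y \<otimes> x = nf (c + c') A' B'"
      by (simp_all add: x y nf_mult A_def A'_def B_def B'_def add.commute)
    have par: "even c \<longrightarrow> even a \<and> even b" "even c' \<longrightarrow> even a' \<and> even b'"
      "odd c \<and> odd c' \<longrightarrow> (even a \<longleftrightarrow> even a') \<and> (even b \<longleftrightarrow> even b')"
      using px py by auto
    have "4 dvd A - A'"
      using par unfolding A_def A'_def by presburger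
    moreover have "4 dvd B - B'"
      using par unfolding B_def B'_def by presburger
    ultimately obtain i j where "A - A' = 4 * i" "B - B' = 4 * j"
      unfolding dvd_def by blast
    then have i: "A = A' + 4 * i" and j: "B = B' + 4 * j"
      by simp_all
    \<comment> \<open>The sign depends on whether \<open>y x\<close> inverts \<open>\<tau>\<close>; the correction \<open>N i\<close> comes from \<open>\<sigma>\<^sup>4\<^sup>i = \<tau>\<^sup>4\<^sup>N\<^sup>i\<close>.\<close>
    define k where "k = (if even (c + c') then j - N * i else N * i - j)"
    have "x \<otimes> y = nf 0 0 (4 * k) \<otimes> (y \<otimes> x)"
      unfolding xy yx nf_mult nf_eq_iff by (simp add: i j k_def algebra_simps)
    then have "x \<otimes> y \<otimes> inv x \<otimes> inv y = nf 0 0 (4 * k) \<otimes> (y \<otimes> x) \<otimes> inv x \<otimes> inv y"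
      by simp
    also have "\<dots> = nf 0 0 (4 * k) \<otimes> (y \<otimes> (x \<otimes> inv x) \<otimes> inv y)"
      unfolding x y by (simp only: m_assoc nf_closed m_closed inv_closed)
    also have "\<dots> = nf 0 0 (4 * k)"
      by (simp add: x y)
    also have "\<dots> \<in> ?D"
      unfolding nf_in_generate_t4 by simp
    finally show ?thesis .
  qed
  show "derived G H \<subseteq> ?D"
    unfolding derived_def using comm by (intro generate_subgroup_incl D) blast
  define y where "y = nf 1 (of_bool p) (of_bool q)"
  have y: "y \<in> H" "nf 0 0 2 \<in> H"
    by (simp_all add: H y_def)
  have "nf 0 0 2 \<otimes> y = nf 0 0 4 \<otimes> (y \<otimes> nf 0 0 2)"
    by (simp add: y_def nf_mult)
  then have "nf 0 0 2 \<otimes> y \<otimes> inv (nf 0 0 2) \<otimes> inv y = nf 0 0 4 \<otimes> (y \<otimes> nf 0 0 2) \<otimes> inv (nf 0 0 2) \<otimes> inv y"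
    by simp
  also have "\<dots> = nf 0 0 4 \<otimes> (y \<otimes> (nf 0 0 2 \<otimes> inv (nf 0 0 2)) \<otimes> inv y)"
    unfolding y_def by (simp only: m_assoc nf_closed m_closed inv_closed)
  also have "\<dots> = t [^] (4::int)"
    by (simp add: y_def t4)
  finally have "t [^] (4::int) \<in> derived_set G H"
    using y by blast
  then have "t [^] (4::int) \<in> derived G H"
    unfolding derived_def by (rule generate.incl)
  then show "?D \<subseteq> derived G H"
    unfolding H
    by (intro generate_subgroup_incl derived_is_subgroup parity_subgroup_closed) simp
qed

text \<open>The generators are \<open>\<tau>\<^sup>2\<close>, of order \<open>2\<close> modulo \<open>\<tau>\<^sup>4\<close>, and any element \<open>y\<close> with odd \<open>\<rho>\<close>-exponent: modulo
  \<open>\<tau>\<^sup>4\<close> its square is \<open>\<rho>\<^sup>2\<close>, of order \<open>2\<close>, so \<open>y\<close> has order \<open>4\<close>.\<close>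
lemma abelianization_odd:
  assumes H: "H = parity_subgroup (True, p, q)"
  shows "of_abelian_type (abelianization G H) [2, 4]"
proof (rule abelianization_of_type_two)
  show sub: "subgroup H G"
    unfolding H by (rule subgroup_parity_subgroup)
  define \<alpha> \<beta> where "\<alpha> = (of_bool p :: int)" and "\<beta> = (of_bool q :: int)"
  define y where "y = nf 1 \<alpha> \<beta>"
  show "nf 0 0 2 \<in> H" and yH: "nf 1 \<alpha> \<beta> \<in> H"
    by (simp_all add: H \<alpha>_def \<beta>_def)
  have "y [^] (2::int) = y \<otimes> y"
    using int_pow_mult[of y 1 1] by (simp add: y_def)
  then have y2: "y [^] (2::int) = nf 2 (4 * \<alpha>) 0"
    by (simp add: y_def nf_mult)
  have yeven: "y [^] (2 * l) = nf (2 * l) (4 * \<alpha> * l) 0" for l :: int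
  proof -
    have "y [^] (2 * l) = (y [^] (2::int)) [^] l"
      by (simp add: int_pow_pow y_def)
    then show ?thesis
      by (simp add: y2 nf_pow_even algebra_simps)
  qed
  have even_pow: "nf 0 0 2 [^] i \<otimes> y [^] (2 * l) = nf (2 * l) (4 * \<alpha> * l) (2 * i)" for i l :: int
    unfolding yeven by (simp add: nf_pow_even nf_mult algebra_simps)
  have odd_pow: "nf 0 0 2 [^] i \<otimes> y [^] (2 * l + 1) = nf (2 * l + 1) (12 * \<alpha> * l + \<alpha>) (\<beta> - 2 * i)" for i l :: int
  proof -
    have "nf 0 0 2 [^] i \<otimes> y [^] (2 * l + 1) = (nf 0 0 2 [^] i \<otimes> y [^] (2 * l)) \<otimes> y"
      by (simp add: int_pow_mult y_def m_assoc)
    then show ?thesis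
      unfolding even_pow by (simp add: y_def nf_mult algebra_simps)
  qed
  show "\<exists>(i::int) (j::int). z = nf 0 0 2 [^] i \<otimes> nf 1 \<alpha> \<beta> [^] j" if z: "z \<in> H" for z
  proof -
    obtain c a b where nf: "z = nf c a b"
      and par: "(odd c, odd a, odd b) = zero_parity \<or> (odd c, odd a, odd b) = (True, p, q)"
      using z unfolding H by (rule parity_subgroupE)
    show ?thesis
    proof (cases "even c")
      case True
      then have "even a" "even b" using par by auto
      then obtain c' a' b' where e: "c = 2 * c'" "a = 2 * a'" "b = 2 * b'"
        using True by (metis evenE)
      define l where "l = c' + a'"
      define i where "i = b' - N * a' + 2 * N * \<alpha> * l"
      have "z = nf (2 * l) (4 * \<alpha> * l) (2 * i)"
        unfolding nf e nf_eq_iff by (simp add: l_def i_def algebra_simps)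
      then show ?thesis
        unfolding even_pow[symmetric] y_def by blast
    next
      case False
      then have "even (a - \<alpha>)" "even (b - \<beta>)" "even (c - 1)"
        using par by (auto simp: \<alpha>_def \<beta>_def)
      then obtain c' a' b' where "c - 1 = 2 * c'" "a - \<alpha> = 2 * a'" "b - \<beta> = 2 * b'"
        by (metis evenE)
      then have e: "c = 2 * c' + 1" "a = 2 * a' + \<alpha>" "b = 2 * b' + \<beta>"
        by simp_all
      define l where "l = c' + a'"
      define i where "i = N * a' - b' - 6 * N * \<alpha> * l"
      have "z = nf (2 * l + 1) (12 * \<alpha> * l + \<alpha>) (\<beta> - 2 * i)"
        unfolding nf e nf_eq_iff by (simp add: l_def i_def algebra_simps)
      then show ?thesis
        unfolding odd_pow[symmetric] y_def by blast
    qed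
  qed
  show "nf 0 0 2 [^] i \<otimes> nf 1 \<alpha> \<beta> [^] j \<in> derived G H \<longleftrightarrow> int 2 dvd i \<and> int 4 dvd j" for i j :: int
  proof (cases "even j")
    case True
    then obtain l where j: "j = 2 * l" by blast
    have "4 dvd 2 * i - N * (4 * \<alpha> * l) \<longleftrightarrow> 4 dvd 2 * i"
      by (rule dvd_diff_left_iff) simp
    moreover have "4 dvd 2 * i \<longleftrightarrow> even i" "4 dvd 2 * l \<longleftrightarrow> even l"
      by presburger+
    moreover have "4 dvd 2 * l + 4 * \<alpha> * l \<longleftrightarrow> 4 dvd 2 * l"
      by (rule dvd_add_left_iff) simp
    ultimately show ?thesis
      unfolding derived_odd[OF H] y_def[symmetric] j even_pow nf_in_generate_t4 by auto
  next
    case False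
    then obtain l where j: "j = 2 * l + 1" by (elim oddE)
    have "\<not> 4 dvd j"
      using False by presburger
    then show ?thesis
      unfolding derived_odd[OF H] y_def[symmetric] j odd_pow nf_in_generate_t4 by simp
  qed
qed simp_all

text \<open>Inside \<open>\<langle>\<sigma>, \<tau>\<rangle>\<close> the criterion on two generators becomes a system of two linear congruences. Elements
  are normalized to have \<open>\<rho>\<close>-exponent \<open>0\<close>.\<close>
lemma abelianization_even:
  assumes H: "H = parity_subgroup (False, p, q)"
    and x: "nf 0 a b \<in> H" and y: "nf 0 a' b' \<in> H" and m: "m > 0" and k: "k > 0"
    and gens: "\<And>z w. nf 0 z w \<in> H \<Longrightarrow>
      \<exists>i j. 4 dvd z - (i * a + j * a') \<and> 8 * N dvd (w - N * z) - (i * (b - N * a) + j * (b' - N * a'))"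
    and rel: "\<And>i j. 4 dvd i * a + j * a' \<and> 8 * N dvd i * (b - N * a) + j * (b' - N * a') \<longleftrightarrow>
      int m dvd i \<and> int k dvd j"
  shows "of_abelian_type (abelianization G H) [m, k]"
proof (rule abelianization_of_type_two[OF _ x y m k])
  show sub: "subgroup H G"
    unfolding H by (rule subgroup_parity_subgroup)
  have pow: "nf 0 a b [^] i \<otimes> nf 0 a' b' [^] j = nf 0 (i * a + j * a') (i * b + j * b')" for i j :: int
    by (simp add: nf_pow_even nf_mult)
  show "\<exists>(i::int) (j::int). z = nf 0 a b [^] i \<otimes> nf 0 a' b' [^] j" if z: "z \<in> H" for z
  proof -
    obtain c d e where nf: "z = nf c d e" and "even c"
      using z unfolding H by (rule even_parity_subgroupE)
    \<comment> \<open>Replace \<open>\<rho>\<^sup>c\<close>, for even \<open>c\<close>, by \<open>\<sigma>\<^sup>c \<tau>\<^sup>N\<^sup>c\<close>.\<close>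
    then have z0: "z = nf 0 (c + d) (e + N * c)"
      by (simp add: nf_eq_iff algebra_simps)
    then obtain i j where "4 dvd c + d - (i * a + j * a')"
      "8 * N dvd (e + N * c - N * (c + d)) - (i * (b - N * a) + j * (b' - N * a'))"
      using gens z by blast
    then have "z = nf 0 (i * a + j * a') (i * b + j * b')"
      unfolding z0 nf_eq_iff by (simp add: algebra_simps)
    then show ?thesis
      unfolding pow by blast
  qed
  show "nf 0 a b [^] i \<otimes> nf 0 a' b' [^] j \<in> derived G H \<longleftrightarrow> int m dvd i \<and> int k dvd j" for i j :: int
  proof -
    have "nf 0 (i * a + j * a') (i * b + j * b') = nf 0 0 0 \<longleftrightarrow>
        4 dvd i * a + j * a' \<and> 8 * N dvd i * (b - N * a) + j * (b' - N * a')"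
      unfolding nf_eq_iff by (simp add: algebra_simps)
    then show ?thesis
      unfolding derived_even[OF H] pow rel nf_one by simp
  qed
qed

section \<open>The seven subgroups\<close>

lemma nat_pow_numeral: "x [^] (numeral k :: nat) = x [^] (numeral k :: int)"
  using int_pow_int[of G x "numeral k"] by (simp only: of_nat_numeral)

lemma s2: "s [^] (2::nat) = nf 0 2 0" and t2: "t [^] (2::nat) = nf 0 0 2"
proof -
  show "s [^] (2::nat) = nf 0 2 0"
    unfolding nat_pow_numeral nf_def using s t by simp
  show "t [^] (2::nat) = nf 0 0 2"
    unfolding nat_pow_numeral nf_def using s t by simp
qed

lemma generate_sigma_tau2: "generate G {s, t [^] (2::nat)} = parity_subgroup (False, True, False)"
proof -
  let ?K = "generate G {nf 0 1 0, nf 0 0 2}"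
  have "nf 0 1 0 \<otimes> nf 0 1 0 \<in> ?K"
    by (intro generate.eng generate.incl) simp_all
  then have "?K = parity_subgroup (False, True, False)"
    by (intro generate_eq_parity_subgroup) (simp_all add: nf_mult generate.incl)
  then show ?thesis
    unfolding nf_s t2 .
qed

lemma generate_tau_sigma2: "generate G {t, s [^] (2::nat)} = parity_subgroup (False, False, True)"
proof -
  let ?K = "generate G {nf 0 0 1, nf 0 2 0}"
  have "nf 0 0 1 \<otimes> nf 0 0 1 \<in> ?K"
    by (intro generate.eng generate.incl) simp_all
  then have "?K = parity_subgroup (False, False, True)"
    by (intro generate_eq_parity_subgroup) (simp_all add: nf_mult generate.incl)
  then show ?thesis
    unfolding nf_t s2 .
qed

lemma generate_sigmatau_sigma2: "generate G {s \<otimes> t, s [^] (2::nat)} = parity_subgroup (False, True, True)"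
proof -
  have st: "s \<otimes> t = nf 0 1 1"
    using s t by (simp add: nf_def)
  show ?thesis
    unfolding s2 st
  proof (rule generate_eq_parity_subgroup)
    let ?K = "generate G {nf 0 1 1, nf 0 2 0}"
    have "inv (nf 0 2 0) \<in> ?K"
      by (intro generate.inv) simp
    moreover have "inv (nf 0 2 0) = nf 0 (-2) 0"
      by (rule inv_equality) (simp_all add: nf_mult nf_one)
    ultimately have "nf 0 1 1 \<otimes> nf 0 1 1 \<otimes> nf 0 (-2) 0 \<in> ?K"
      by (intro generate.eng) (simp_all add: generate.incl)
    then show "nf 0 0 2 \<in> ?K" by (simp add: nf_mult)
  qed (simp_all add: generate.incl)
qed

text \<open>The square of \<open>\<rho> \<sigma>\<^sup>a \<tau>\<^sup>b\<close> is \<open>\<rho>\<^sup>2 \<sigma>\<^sup>4\<^sup>a\<close>, which equals \<open>\<sigma>\<^sup>2\<close> up to an even power of \<open>\<tau>\<close>.\<close>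
lemma generate_odd_tau2:
  "generate G {nf 1 a b, t [^] (2::nat)} = parity_subgroup (True, odd a, odd b)"
  unfolding t2
proof (rule generate_eq_parity_subgroup)
  let ?K = "generate G {nf 1 a b, nf 0 0 2}"
  have K: "subgroup ?K G"
    by (intro generate_is_subgroup) simp
  have "nf 0 0 2 [^] (2 * N * a - N) \<in> ?K"
    by (intro subgroup_int_pow_closed[OF K] generate.incl) simp
  then have "nf 1 a b \<otimes> nf 1 a b \<otimes> nf 0 0 2 [^] (2 * N * a - N) \<in> ?K"
    by (intro generate.eng) (simp_all add: generate.incl)
  moreover have "nf 1 a b \<otimes> nf 1 a b \<otimes> nf 0 0 2 [^] (2 * N * a - N) = nf 0 2 0"
    by (simp add: nf_mult nf_pow_even nf_eq_iff algebra_simps)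
  ultimately show "nf 0 2 0 \<in> ?K" by simp
qed (simp_all add: generate.incl)

text \<open>For \<open>N = 1\<close> the element \<open>\<sigma>\<^sup>2 \<tau>\<^sup>2\<close> has order \<open>2\<close> and complements \<open>\<langle>\<sigma>\<rangle>\<close>, which has order \<open>8\<close>.\<close>
lemma type_sigma_tau2_1:
  assumes "N = 1"
  shows "of_abelian_type (abelianization G (parity_subgroup (False, True, False))) [2, 8]"
proof (rule abelianization_even[OF HOL.refl, of 2 2 _ _ 1 0])
  fix z w assume "nf 0 z w \<in> parity_subgroup (False, True, False)"
  then have "even w" by auto
  then obtain i where "w = 2 * i" by blast
  then show "\<exists>i j. 4 dvd z - (i * 2 + j * 1) \<and> 8 * N dvd w - N * z - (i * (2 - N * 2) + j * (0 - N * 1))"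
    by (intro exI[of _ i] exI[of _ "z - w"]) (simp add: assms algebra_simps)
next
  show "4 dvd i * 2 + j * 1 \<and> 8 * N dvd i * (2 - N * 2) + j * (0 - N * 1) \<longleftrightarrow> int 2 dvd i \<and> int 8 dvd j" for i j
    unfolding assms by simp presburger
qed simp_all

text \<open>Now the order of \<open>\<tau>\<^sup>2\<close> is at least that of \<open>\<sigma>\<close>, and \<open>\<sigma>\<close> has to be corrected: since \<open>\<sigma>\<^sup>4 = \<tau>\<^sup>4\<^sup>N\<close>, the element
  \<open>\<sigma> \<tau>\<^sup>-\<^sup>N\<close>, which belongs to the subgroup because \<open>N\<close> is even, has order \<open>4\<close>.\<close>
lemma type_sigma_tau2_even:
  assumes even_N: "even N" and k: "int k = 4 * N"
  shows "of_abelian_type (abelianization G (parity_subgroup (False, True, False))) [4, k]"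
proof (rule abelianization_even[OF HOL.refl, of 1 "- N" _ _ 0 2])
  obtain M where M: "N = 2 * M" using even_N by blast
  fix z w assume "nf 0 z w \<in> parity_subgroup (False, True, False)"
  then have "even w" by auto
  then obtain v where v: "w = 2 * v" by blast
  show "\<exists>i j. 4 dvd z - (i * 1 + j * 0) \<and> 8 * N dvd w - N * z - (i * (- N - N * 1) + j * (2 - N * 0))"
    by (intro exI[of _ z] exI[of _ "v + M * z"]) (simp add: v M algebra_simps)
next
  show "4 dvd i * 1 + j * 0 \<and> 8 * N dvd i * (- N - N * 1) + j * (2 - N * 0) \<longleftrightarrow> int 4 dvd i \<and> int k dvd j"
    for i j
  proof -
    have "8 * N dvd i * (- N - N * 1) + j * (2 - N * 0) \<longleftrightarrow> 2 * (4 * N) dvd 2 * (j - N * i)"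
      by (simp add: algebra_simps)
    also have "\<dots> \<longleftrightarrow> 4 * N dvd j - N * i"
      by (subst dvd_mult_cancel_left) simp
    finally have *: "8 * N dvd i * (- N - N * 1) + j * (2 - N * 0) \<longleftrightarrow> 4 * N dvd j - N * i" .
    have "4 * N dvd j - N * i \<longleftrightarrow> 4 * N dvd j" if "4 dvd i"
    proof (rule dvd_diff_left_iff)
      show "4 * N dvd N * i"
        using mult_dvd_mono[OF dvd_refl that, of N] by (simp add: mult.commute)
    qed
    then show ?thesis
      unfolding * k by auto
  qed
next
  show "k > 0" using k N_pos by linarith
qed (use even_N in simp_all)

text \<open>Here \<open>\<sigma>\<^sup>2 \<tau>\<^sup>-\<^sup>2\<^sup>N\<close> is an involution outside \<open>\<langle>\<tau>\<rangle>\<close>.\<close>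
lemma type_tau_sigma2:
  assumes k: "int k = 8 * N"
  shows "of_abelian_type (abelianization G (parity_subgroup (False, False, True))) [2, k]"
proof (rule abelianization_even[OF HOL.refl, of 2 "- 2 * N" _ _ 0 1])
  fix z w assume "nf 0 z w \<in> parity_subgroup (False, False, True)"
  then have "even z" by auto
  then obtain i where i: "z = 2 * i" by blast
  show "\<exists>i j. 4 dvd z - (i * 2 + j * 0) \<and> 8 * N dvd w - N * z - (i * (- 2 * N - N * 2) + j * (1 - N * 0))"
    by (intro exI[of _ i] exI[of _ "w - N * z + 4 * N * i"]) (simp add: i algebra_simps)
next
  show "4 dvd i * 2 + j * 0 \<and> 8 * N dvd i * (- 2 * N - N * 2) + j * (1 - N * 0) \<longleftrightarrow> int 2 dvd i \<and> int k dvd j"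
    for i j
  proof -
    have *: "i * (- 2 * N - N * 2) + j * (1 - N * 0) = j - 4 * N * i"
      by (simp add: algebra_simps)
    have "8 * N dvd j - 4 * N * i \<longleftrightarrow> 8 * N dvd j" if "even i"
    proof (rule dvd_diff_left_iff)
      show "8 * N dvd 4 * N * i"
        using that by (auto simp: algebra_simps)
    qed
    moreover have "4 dvd i * 2 + j * 0 \<longleftrightarrow> even i" by simp presburger
    ultimately show ?thesis
      unfolding * k by auto
  qed
next
  show "k > 0" using k N_pos by linarith
qed simp_all

text \<open>For \<open>N = 1\<close> one has \<open>(\<sigma> \<tau>)\<^sup>4 = \<sigma>\<^sup>4 \<tau>\<^sup>4 = \<sigma>\<^sup>8 = 1\<close>, so both generators have order \<open>4\<close>.\<close>
lemma type_sigmatau_sigma2_1: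
  assumes "N = 1"
  shows "of_abelian_type (abelianization G (parity_subgroup (False, True, True))) [4, 4]"
proof (rule abelianization_even[OF HOL.refl, of 1 1 _ _ 2 0])
  fix z w assume "nf 0 z w \<in> parity_subgroup (False, True, True)"
  then have "even (z - w)" by auto
  then obtain j where "z - w = 2 * j" by blast
  then show "\<exists>i j. 4 dvd z - (i * 1 + j * 2) \<and> 8 * N dvd w - N * z - (i * (1 - N * 1) + j * (0 - N * 2))"
    by (intro exI[of _ w] exI[of _ j]) (simp add: assms algebra_simps)
next
  show "4 dvd i * 1 + j * 2 \<and> 8 * N dvd i * (1 - N * 1) + j * (0 - N * 2) \<longleftrightarrow> int 4 dvd i \<and> int 4 dvd j" for i j
    unfolding assms by simp presburger
qed simp_all

text \<open>The involution \<open>\<sigma>\<^sup>2 \<tau>\<^sup>-\<^sup>2\<^sup>N\<close> complements \<open>\<langle>\<sigma> \<tau>\<rangle>\<close>. The invariant \<open>b - N a\<close> of \<open>(\<sigma> \<tau>)\<^sup>j\<close> is \<open>(1 - N) j\<close>, and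
  for even \<open>N\<close> the factor \<open>1 - N\<close> is a unit modulo \<open>8 N\<close>; therefore \<open>\<sigma> \<tau>\<close> has order \<open>8 N\<close>.\<close>
lemma type_sigmatau_sigma2_even:
  assumes even_N: "even N" and k: "int k = 8 * N"
  shows "of_abelian_type (abelianization G (parity_subgroup (False, True, True))) [2, k]"
proof (rule abelianization_even[OF HOL.refl, of 2 "- 2 * N" _ _ 1 1])
  have "coprime (1 - N) N"
  proof (rule coprimeI)
    fix d assume "d dvd 1 - N" "d dvd N"
    then have "d dvd 1 - N + N" by (rule dvd_add)
    then show "is_unit d" by simp
  qed
  moreover have cop2: "coprime (1 - N) 2"
    using even_N by simp
  ultimately have cop: "coprime (1 - N) (8 * N)"
    using coprime_power_right_iff[of "1 - N" 2 3] by simp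
  {
    \<comment> \<open>An inverse \<open>e\<close> of \<open>1 - N\<close> modulo \<open>8 N\<close> solves for \<open>j\<close>. As \<open>j\<close> enters the
       first congruence only through its value \<open>j0\<close> modulo \<open>4\<close>, \<open>i\<close> can be chosen before \<open>j\<close>.\<close>
    obtain e q' where "e * (1 - N) + q' * (8 * N) = gcd (1 - N) (8 * N)"
      using bezout_int by blast
    then have q: "(1 - N) * e = 1 + 8 * N * (- q')"
      using cop by (simp add: algebra_simps)
    then have "odd ((1 - N) * e)" by simp
    then have e: "odd e" by simp
    fix z w assume "nf 0 z w \<in> parity_subgroup (False, True, True)"
    then have zw: "even (z - w)" by auto
    define j0 where "j0 = e * (w - N * z)"
    have "even (z - j0)"
      using zw e even_N by (auto simp: j0_def)
    then obtain i where i: "z - j0 = 2 * i" by blast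
    have "4 dvd z - (i * 2 + (j0 + 4 * N * e * i) * 1)"
      using i by (simp add: algebra_simps)
    moreover have "8 * N dvd w - N * z - (i * (- 2 * N - N * 2) + (j0 + 4 * N * e * i) * (1 - N * 1))"
    proof -
      define y where "y = w - N * z + 4 * N * i"
      have "w - N * z - (i * (- 2 * N - N * 2) + (j0 + 4 * N * e * i) * (1 - N * 1)) = y - ((1 - N) * e) * y"
        by (simp add: j0_def y_def algebra_simps)
      also have "\<dots> = 8 * N * (q' * y)"
        unfolding q by (simp add: algebra_simps)
      finally show ?thesis by simp
    qed
    ultimately show "\<exists>i j. 4 dvd z - (i * 2 + j * 1) \<and>
        8 * N dvd w - N * z - (i * (- 2 * N - N * 2) + j * (1 - N * 1))"
      by blast
  }
  show "4 dvd i * 2 + j * 1 \<and> 8 * N dvd i * (- 2 * N - N * 2) + j * (1 - N * 1) \<longleftrightarrow> int 2 dvd i \<and> int k dvd j"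
    for i j
  proof -
    have *: "i * (- 2 * N - N * 2) + j * (1 - N * 1) = (1 - N) * j - 4 * N * i"
      by (simp add: algebra_simps)
    have iff: "8 * N dvd (1 - N) * j - 4 * N * i \<longleftrightarrow> 8 * N dvd j" if "even i"
    proof -
      have "8 * N dvd 4 * N * i"
        using that by (auto simp: algebra_simps)
      then have "8 * N dvd (1 - N) * j - 4 * N * i \<longleftrightarrow> 8 * N dvd (1 - N) * j"
        by (rule dvd_diff_left_iff)
      then show ?thesis
        using cop by (simp add: coprime_dvd_mult_right_iff coprime_commute)
    qed
    have "even i \<and> 4 dvd j" if "4 dvd i * 2 + j" "8 * N dvd (1 - N) * j - 4 * N * i"
    proof -
      have "4 dvd (1 - N) * j - 4 * N * i"
        using that(2) by (rule dvd_trans[rotated]) simp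
      then have "4 dvd (1 - N) * j"
        by (simp add: dvd_diff_left_iff)
      moreover have "coprime 4 (1 - N)"
        using cop2 coprime_power_right_iff[of "1 - N" 2 2] by (simp add: coprime_commute)
      ultimately have "4 dvd j"
        by (simp add: coprime_dvd_mult_right_iff)
      then show ?thesis
        using that(1) by presburger
    qed
    moreover have "4 dvd i * 2 + j" if "even i" "8 * N dvd j"
    proof -
      have "4 dvd j"
        using that(2) by (rule dvd_trans[rotated]) simp
      then show ?thesis
        using that(1) by presburger
    qed
    ultimately show ?thesis
      unfolding * k using iff by auto
  qed
next
  show "k > 0" using k N_pos by linarith
qed simp_all

end

section \<open>The normal form in the presented group\<close>

text \<open>The relations are read off from the presentation, after rewriting the commutators as conjugation
  rules. Uniqueness of the normal form is where the action on triples enters.\<close>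
lemma normal_form_group_G_grp:
  assumes n: "n \<ge> 1"
  shows "normal_form_group (G_grp n) (2 ^ (n - 1)) (G_gen n Sigma_gen) (G_gen n Tau_gen) (G_gen n Rho_gen)"
proof -
  let ?R = "G_relations n" and ?N = "2 ^ (n - 1) :: int"
  interpret group "G_grp n"
    unfolding G_grp_def by (rule group_presented_group)
  define s t r where "s = G_gen n Sigma_gen" and "t = G_gen n Tau_gen" and "r = G_gen n Rho_gen"
  note gens = s_def t_def r_def G_gen_def
  have cl: "s \<in> carrier (G_grp n)" "t \<in> carrier (G_grp n)" "r \<in> carrier (G_grp n)"
    by (simp_all add: gens G_grp_def)
  have cls: "word_class ?R (word_gen Sigma_gen) = s" "word_class ?R (word_gen Tau_gen) = t"
    "word_class ?R (word_gen Rho_gen) = r"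
    by (simp_all add: gens)
  have app: "word_class ?R (u @ v) = word_class ?R u \<otimes>\<^bsub>G_grp n\<^esub> word_class ?R v" for u v
    by (simp add: G_grp_def)
  have rel: "word_class ?R u = word_class ?R v" if "(u, v) \<in> ?R" for u v
    using that by (rule word_class_relation)
  note hom = app word_class_pow[of ?R, folded G_grp_def] word_class_inv[of ?R, folded G_grp_def]
    one_presented_group[of ?R, folded G_grp_def, symmetric] cls word_comm_def
  have R: "s [^]\<^bsub>G_grp n\<^esub> (8::nat) = \<one>\<^bsub>G_grp n\<^esub>"
    "t [^]\<^bsub>G_grp n\<^esub> (2 ^ (n + 2) :: nat) = \<one>\<^bsub>G_grp n\<^esub>"
    "s [^]\<^bsub>G_grp n\<^esub> (4::nat) = t [^]\<^bsub>G_grp n\<^esub> (2 ^ (n + 1) :: nat)"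
    "r [^]\<^bsub>G_grp n\<^esub> (2::nat) = t [^]\<^bsub>G_grp n\<^esub> (2 ^ n :: nat) \<otimes>\<^bsub>G_grp n\<^esub> s [^]\<^bsub>G_grp n\<^esub> (2::nat)"
    "inv\<^bsub>G_grp n\<^esub> t \<otimes>\<^bsub>G_grp n\<^esub> (inv\<^bsub>G_grp n\<^esub> s \<otimes>\<^bsub>G_grp n\<^esub> (t \<otimes>\<^bsub>G_grp n\<^esub> s)) = \<one>\<^bsub>G_grp n\<^esub>"
    "inv\<^bsub>G_grp n\<^esub> r \<otimes>\<^bsub>G_grp n\<^esub> (inv\<^bsub>G_grp n\<^esub> s \<otimes>\<^bsub>G_grp n\<^esub> (r \<otimes>\<^bsub>G_grp n\<^esub> s)) = (inv\<^bsub>G_grp n\<^esub> s) [^]\<^bsub>G_grp n\<^esub> (2::nat)"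
    "inv\<^bsub>G_grp n\<^esub> r \<otimes>\<^bsub>G_grp n\<^esub> (inv\<^bsub>G_grp n\<^esub> t \<otimes>\<^bsub>G_grp n\<^esub> (r \<otimes>\<^bsub>G_grp n\<^esub> t)) = t [^]\<^bsub>G_grp n\<^esub> (2::nat)"
    unfolding hom[symmetric] by (rule rel, simp add: G_relations_def Let_def word_comm_def)+
  show ?thesis
    unfolding s_def[symmetric] t_def[symmetric] r_def[symmetric]
  proof unfold_locales
    show "?N \<ge> 1" by simp
    show "s [^]\<^bsub>G_grp n\<^esub> (8::int) = \<one>\<^bsub>G_grp n\<^esub>"
      using R(1) int_pow_int[of "G_grp n" s 8] by simp
    have pow2: "8 * ?N = int (2 ^ (n + 2))" "4 * ?N = int (2 ^ (n + 1))" "2 * ?N = int (2 ^ n)"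
      using n by (cases n; simp)+
    show "t [^]\<^bsub>G_grp n\<^esub> (8 * ?N) = \<one>\<^bsub>G_grp n\<^esub>"
      unfolding pow2 int_pow_int by (rule R)
    show "s [^]\<^bsub>G_grp n\<^esub> (4::int) = t [^]\<^bsub>G_grp n\<^esub> (4 * ?N)"
      unfolding pow2 int_pow_int using R(3) int_pow_int[of "G_grp n" s 4] by simp
    show "r [^]\<^bsub>G_grp n\<^esub> (2::int) = t [^]\<^bsub>G_grp n\<^esub> (2 * ?N) \<otimes>\<^bsub>G_grp n\<^esub> s [^]\<^bsub>G_grp n\<^esub> (2::int)"
      unfolding pow2 int_pow_int
      using R(4) int_pow_int[of "G_grp n" s 2] int_pow_int[of "G_grp n" r 2] by simp
    show "t \<otimes>\<^bsub>G_grp n\<^esub> s = s \<otimes>\<^bsub>G_grp n\<^esub> t"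
      using R(5) cl by (simp add: inv_solve_left')
    have sq: "x [^]\<^bsub>G_grp n\<^esub> (2::nat) = x \<otimes>\<^bsub>G_grp n\<^esub> x" if "x \<in> carrier (G_grp n)" for x
      using that by (simp add: numeral_2_eq_2)
    have canc: "x \<otimes>\<^bsub>G_grp n\<^esub> (inv\<^bsub>G_grp n\<^esub> x \<otimes>\<^bsub>G_grp n\<^esub> y) = y" if "x \<in> carrier (G_grp n)" "y \<in> carrier (G_grp n)" for x y
      using that by (simp add: m_assoc[symmetric])
    have s3: "s [^]\<^bsub>G_grp n\<^esub> (3::int) = s \<otimes>\<^bsub>G_grp n\<^esub> s \<otimes>\<^bsub>G_grp n\<^esub> s"
      using cl int_pow_int[of "G_grp n" s 3] by (simp add: numeral_3_eq_3)
    have "r \<otimes>\<^bsub>G_grp n\<^esub> s = s \<otimes>\<^bsub>G_grp n\<^esub> (r \<otimes>\<^bsub>G_grp n\<^esub> (inv\<^bsub>G_grp n\<^esub> s \<otimes>\<^bsub>G_grp n\<^esub> inv\<^bsub>G_grp n\<^esub> s))"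
      using R(6) cl by (simp add: sq inv_solve_left')
    then have "r \<otimes>\<^bsub>G_grp n\<^esub> s \<otimes>\<^bsub>G_grp n\<^esub> s \<otimes>\<^bsub>G_grp n\<^esub> s = s \<otimes>\<^bsub>G_grp n\<^esub> r"
      using cl by (simp add: m_assoc)
    then show "s \<otimes>\<^bsub>G_grp n\<^esub> r = r \<otimes>\<^bsub>G_grp n\<^esub> s [^]\<^bsub>G_grp n\<^esub> (3::int)"
      using cl by (simp add: s3 m_assoc)
    have "r \<otimes>\<^bsub>G_grp n\<^esub> t = t \<otimes>\<^bsub>G_grp n\<^esub> (r \<otimes>\<^bsub>G_grp n\<^esub> (t \<otimes>\<^bsub>G_grp n\<^esub> t))"
      using R(7) cl by (simp add: sq inv_solve_left')
    then have "r \<otimes>\<^bsub>G_grp n\<^esub> t \<otimes>\<^bsub>G_grp n\<^esub> inv\<^bsub>G_grp n\<^esub> t \<otimes>\<^bsub>G_grp n\<^esub> inv\<^bsub>G_grp n\<^esub> t = t \<otimes>\<^bsub>G_grp n\<^esub> (r \<otimes>\<^bsub>G_grp n\<^esub> (t \<otimes>\<^bsub>G_grp n\<^esub> t)) \<otimes>\<^bsub>G_grp n\<^esub> inv\<^bsub>G_grp n\<^esub> t \<otimes>\<^bsub>G_grp n\<^esub> inv\<^bsub>G_grp n\<^esub> t"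
      by simp
    moreover have "t \<otimes>\<^bsub>G_grp n\<^esub> (r \<otimes>\<^bsub>G_grp n\<^esub> (t \<otimes>\<^bsub>G_grp n\<^esub> t)) \<otimes>\<^bsub>G_grp n\<^esub> inv\<^bsub>G_grp n\<^esub> t \<otimes>\<^bsub>G_grp n\<^esub> inv\<^bsub>G_grp n\<^esub> t = t \<otimes>\<^bsub>G_grp n\<^esub> r"
      using cl canc by (simp add: m_assoc)
    moreover have "r \<otimes>\<^bsub>G_grp n\<^esub> t \<otimes>\<^bsub>G_grp n\<^esub> inv\<^bsub>G_grp n\<^esub> t \<otimes>\<^bsub>G_grp n\<^esub> inv\<^bsub>G_grp n\<^esub> t = r \<otimes>\<^bsub>G_grp n\<^esub> inv\<^bsub>G_grp n\<^esub> t"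
      using cl canc by (simp add: m_assoc)
    ultimately show "t \<otimes>\<^bsub>G_grp n\<^esub> r = r \<otimes>\<^bsub>G_grp n\<^esub> inv\<^bsub>G_grp n\<^esub> t"
      by simp
    have "range (\<lambda>x. word_class ?R (word_gen x)) = {s, t, r}"
    proof -
      have gens: "(UNIV :: gen set) = {Sigma_gen, Tau_gen, Rho_gen}"
        using gen.exhaust by blast
      show ?thesis
        unfolding gens image_insert image_empty cls ..
    qed
    then show "carrier (G_grp n) = generate (G_grp n) {s, t, r}"
      using carrier_presented_group_generate[of ?R] by (simp add: G_grp_def)
  next
    fix c a b c' a' b' :: int
    define w where "w c a b = word_ipow Rho_gen c @ word_ipow Sigma_gen a @ word_ipow Tau_gen b" for c a b
    have class_w: "word_class ?R (w c a b) =
        r [^]\<^bsub>G_grp n\<^esub> c \<otimes>\<^bsub>G_grp n\<^esub> (s [^]\<^bsub>G_grp n\<^esub> a \<otimes>\<^bsub>G_grp n\<^esub> t [^]\<^bsub>G_grp n\<^esub> b)" for c a b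
      unfolding w_def app word_class_ipow[of ?R, folded G_grp_def] cls ..
    have fold: "fold act (w c a b) (0, 0, 0) = (c, a, b)" for c a b
      by (simp add: w_def word_ipow_def act_sigma_funpow act_tau_funpow act_rho_funpow)
    assume "r [^]\<^bsub>G_grp n\<^esub> c \<otimes>\<^bsub>G_grp n\<^esub> (s [^]\<^bsub>G_grp n\<^esub> a \<otimes>\<^bsub>G_grp n\<^esub> t [^]\<^bsub>G_grp n\<^esub> b) =
        r [^]\<^bsub>G_grp n\<^esub> c' \<otimes>\<^bsub>G_grp n\<^esub> (s [^]\<^bsub>G_grp n\<^esub> a' \<otimes>\<^bsub>G_grp n\<^esub> t [^]\<^bsub>G_grp n\<^esub> b')"
    then have "word_equiv ?R (w c a b) (w c' a' b')"
      unfolding class_w[symmetric] by (simp add: word_class_eq_iff)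
    from fold_act_word_equiv[OF n this, of "(0, 0, 0)"]
    show "same_exps ?N (c, a, b) (c', a', b')"
      unfolding fold .
  qed (use cl in simp_all)
qed

section \<open>The subgroups of index four of the presented group\<close>

theorem mainTheorem2:
  fixes n :: nat
    and G :: "gen gword set monoid" (structure)
    and \<sigma> \<tau> \<rho> :: "gen gword set"
    and H1 H2 H3 H4 H5 H6 H7 :: "gen gword set set"
  assumes "n \<ge> 1"
    and "G = G_grp n"
    and "\<sigma> = G_gen n Sigma_gen" and "\<tau> = G_gen n Tau_gen" and "\<rho> = G_gen n Rho_gen"
    and "H1 = generate G {\<sigma>, \<tau> [^] (2::nat)}"
    and "H2 = generate G {\<tau>, \<sigma> [^] (2::nat)}"
    and "H3 = generate G {\<rho>, \<tau> [^] (2::nat)}"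
    and "H4 = generate G {\<sigma> \<otimes> \<tau>, \<sigma> [^] (2::nat)}"
    and "H5 = generate G {\<sigma> \<otimes> \<rho>, \<tau> [^] (2::nat)}"
    and "H6 = generate G {\<tau> \<otimes> \<rho>, \<tau> [^] (2::nat)}"
    and "H7 = generate G {\<sigma> \<otimes> \<tau> \<otimes> \<rho>, \<tau> [^] (2::nat)}"
  shows "{H. H \<lhd> G \<and> card (rcosets H) = 4} = {H1, H2, H3, H4, H5, H6, H7}
    \<and> card {H1, H2, H3, H4, H5, H6, H7} = 7
    \<and> derived G H1 = {\<one>}
    \<and> of_abelian_type (abelianization G H1) [2 ^ min n 2, 2 ^ max (n + 1) 3]
    \<and> derived G H2 = {\<one>}
    \<and> of_abelian_type (abelianization G H2) [2, 2 ^ (n + 2)]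
    \<and> derived G H3 = generate G {\<tau> [^] (4::nat)}
    \<and> of_abelian_type (abelianization G H3) [2, 4]
    \<and> derived G H4 = {\<one>}
    \<and> (n = 1 \<longrightarrow> of_abelian_type (abelianization G H4) [4, 4])
    \<and> (n \<ge> 2 \<longrightarrow> of_abelian_type (abelianization G H4) [2, 2 ^ (n + 2)])
    \<and> derived G H5 = generate G {\<tau> [^] (4::nat)}
    \<and> of_abelian_type (abelianization G H5) [2, 4]
    \<and> derived G H6 = generate G {\<tau> [^] (4::nat)}
    \<and> of_abelian_type (abelianization G H6) [2, 4]
    \<and> derived G H7 = generate G {\<tau> [^] (4::nat)}
    \<and> of_abelian_type (abelianization G H7) [2, 4]"
proof -
  let ?N = "2 ^ (n - 1) :: int"
  interpret normal_form_group G ?N \<sigma> \<tau> \<rho>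
    unfolding assms(2-5) by (rule normal_form_group_G_grp[OF assms(1)])
  have words: "\<sigma> \<otimes> \<rho> = nf 1 3 0" "\<tau> \<otimes> \<rho> = nf 1 0 (- 1)" "\<sigma> \<otimes> \<tau> \<otimes> \<rho> = nf 1 3 (- 1)"
    using nf_mult_r[of 0 1 0] nf_mult_r[of 0 0 1] nf_mult_r[of 0 1 1] nf_mult_st[of 0 1 0 0 1] s t
    by (simp_all add: nf_s nf_t nf_def[of 0 1 1])
  have H: "H1 = parity_subgroup (False, True, False)" "H2 = parity_subgroup (False, False, True)"
    "H3 = parity_subgroup (True, False, False)" "H4 = parity_subgroup (False, True, True)"
    "H5 = parity_subgroup (True, True, False)" "H6 = parity_subgroup (True, False, True)"
    "H7 = parity_subgroup (True, True, True)"
    unfolding assms(6-12) words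
    using generate_sigma_tau2 generate_tau_sigma2 generate_sigmatau_sigma2
      generate_odd_tau2[of 0 0, unfolded nf_r] generate_odd_tau2[of 3 0] generate_odd_tau2[of 0 "- 1"]
      generate_odd_tau2[of 3 "- 1"]
    by simp_all
  have set: "{H1, H2, H3, H4, H5, H6, H7} = parity_subgroup ` (- {zero_parity})"
    unfolding H parity_UNIV by (simp only: image_insert image_empty insert_commute)
  have index: "{H. H \<lhd> G \<and> card (rcosets H) = 4} = {H1, H2, H3, H4, H5, H6, H7}"
    unfolding set by (rule normal_index_4_eq)
  have card: "card {H1, H2, H3, H4, H5, H6, H7} = 7"
    unfolding set card_image[OF inj_parity_subgroup] by (simp add: parity_UNIV)
  have n_cases: "n = 1 \<and> ?N = 1 \<or> n \<ge> 2 \<and> even ?N"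
    using assms(1) by auto
  have pow: "int (2 ^ (n + 2)) = 8 * ?N" "int (2 ^ (n + 1)) = 4 * ?N"
    using assms(1) by (cases n; simp)+
  have type1: "of_abelian_type (abelianization G H1) [2 ^ min n 2, 2 ^ max (n + 1) 3]"
    using n_cases
  proof
    assume "n = 1 \<and> ?N = 1"
    then show ?thesis
      using type_sigma_tau2_1 unfolding H by simp
  next
    assume n: "n \<ge> 2 \<and> even ?N"
    then have "min n 2 = 2" "max (n + 1) 3 = n + 1"
      by simp_all
    then show ?thesis
      using type_sigma_tau2_even[OF _ pow(2)] n unfolding H by simp
  qed
  have type4: "n = 1 \<longrightarrow> of_abelian_type (abelianization G H4) [4, 4]"
    "n \<ge> 2 \<longrightarrow> of_abelian_type (abelianization G H4) [2, 2 ^ (n + 2)]"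
    using n_cases type_sigmatau_sigma2_1 type_sigmatau_sigma2_even[OF _ pow(1)] unfolding H by auto
  show ?thesis
    unfolding nat_pow_numeral
    by (intro conjI index card type1 type4)
      (simp_all only: H derived_even[OF HOL.refl] derived_odd[OF HOL.refl]
        type_tau_sigma2[OF pow(1)] abelianization_odd[OF HOL.refl])
qed

end
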